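(* Let $n\ge1$, let $\Phi$ be the root system of type $A_n$ with standard positive system $\Phi^+$ and simple system $\Delta=\{\alpha_1,\dots,\alpha_n\}$, let $W=S_{n+1}$, and let $C\mapsto F_C$ be the bijection (described in the context) from biclosed sets in $\Phi$ to quasitrivial semigroup structures on $X_{n+1}=\{1,\dots,n+1\}$. Then: (1) The commutative quasitrivial semigroup structures on $X_{n+1}$ are in bijection with the positive systems of $\Phi$. (2) The anticommutative quasitrivial semigroup structures on $X_{n+1}$ are precisely $F_{\emptyset}=F_{\Phi^+_{\Delta,\emptyset}}$ and $F_{\Phi}=F_{\Phi^+_{\emptyset,\Delta}}$. (3) Under $C\mapsto F_C$, the quasitrivial semigroup structures on $X_{n+1}$ with an identity element (resp. with a zero element) correspond to the biclosed sets of the form $w\Phi^+_{\Delta_1,\Delta_2}$, where $w\in W$ and $\Delta_1,\Delta_2\subset\Delta$ are orthogonal with $\alpha_1\notin\Delta_1\cup\Delta_2$ (resp. $\alpha_n\notin\Delta_1\cup\Delta_2$). (4) Under $C\mapsto F_C$, the parabolic (resp. horocyclic) subsets of $\Phi$ correspond to the quasitrivial semigroup structures $F$ such that $F|_{\{x,y\}}\ne\pi_1$ (resp. $F|_{\{x,y\}}\neq\pi_2$) for any distinct $x,y\in X_{n+1}$.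
   Context: Root system of type $A_n$: $V$ is a real vector space with basis $\alpha_1,\dots,\alpha_n$, and $\Phi=\{\pm(\alpha_i+\cdots+\alpha_k):1\le i\le k\le n\}$, $\Phi^+=\{\alpha_i+\cdots+\alpha_k:1\le i\le k\le n\}$. The bilinear form is $(\alpha_i,\alpha_i)=1$, $(\alpha_i,\alpha_j)=-\frac12$ if $|i-j|=1$, and $0$ if $|i-j|\ge2$. For $1\le j\le k\le n$ put $\alpha_{j,k+1}=\alpha_j+\cdots+\alpha_k$, $\alpha_{k+1,j}=-\alpha_{j,k+1}$. $W=S_{n+1}$ acts on $\Phi$ by $w\alpha_{a,b}=\alpha_{w(a),w(b)}$. The positive systems of $\Phi$ are the sets of roots that are $>0$ for some vector space total order on $V$; equivalently the sets $w\Phi^+$, $w\in W$. Closed/biclosed: $C\subset\Phi$ is closed if $\alpha,\beta\in C$, $\alpha+\beta\in\Phi$ imply $\alpha+\beta\in C$; $C$ is biclosed if $C$ and $\Phi\setminus C$ are closed. For orthogonal subsets $\Delta_1,\Delta_2\subset\Delta$ (i.e. $(\alpha,\beta)=0$ for all $\alpha\in\Delta_1,\beta\in\Delta_2$) put $\Phi^+_{\Delta_1,\Delta_2}=(\Phi^+\setminus \mathrm{span}_{\mathbb R}(\Delta_1))\cup(\mathrm{span}_{\mathbb R}(\Delta_2)\cap\Phi)$. It is known that the biclosed sets in $\Phi$ are exactly the sets $w\Phi^+_{\Delta_1,\Delta_2}$ with $w\in W$ and $\Delta_1,\Delta_2\subset\Delta$ orthogonal. Sets $w\Phi^+_{\emptyset,\Delta_2}$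 are called parabolic subsets and sets $w\Phi^+_{\Delta_1,\emptyset}$ are called horocyclic subsets. A quasitrivial semigroup structure on $X$ is an associative $F:X\times X\to X$ with $F(a,b)\in\{a,b\}$. It is commutative if $F(a,b)=F(b,a)$ for all $a,b$, and anticommutative if $F(a,b)=F(b,a)$ implies $a=b$. An identity element $1$ satisfies $F(1,x)=F(x,1)=x$ for all $x$; a zero element $0$ satisfies $F(0,x)=F(x,0)=0$ for all $x$. $\pi_i(a_1,a_2)=a_i$ are the projections, and $F|_{\{x,y\}}$ is the restriction of $F$ to $\{x,y\}\times\{x,y\}$. The bijection $C\mapsto F_C$ from biclosed sets to quasitrivial semigroup structures: write $C=\sigma(\Phi^+_{\Delta_1,\Delta_2})$. Decompose $\{1,\dots,n+1\}$ into consecutive intervals by putting $i$ and $i+1$ in the same interval iff $\alpha_i\in\Delta_1\cup\Delta_2$; order the intervals from left to right. The images under $\sigma$ of the intervals are the equivalence classes of a total preorder $\precsim$ on $X_{n+1}$, with classes ordered as the intervals are. For an interval $\{i,\dots,i+k\}$ with $k\ge1$, the roots $\alpha_i,\dots,\alpha_{i+k-1}$ all lie in $\Delta_1$ or all lie in $\Delta_2$. Then $F_C(x,y)$ is the $\precsim$-greater of $x,y$ if $x\nsim y$; if $x\sim y$, then $F_C(x,y)=x$ when the class comes from $\Delta_1$ and $F_C(x,y)=y$ when it comes from $\Delta_2$ (and $F_C(x,x)=x$). This is well defined and bijective. *)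

theory Defs
  imports Complex_Main "HOL-Library.FuncSet" "HOL-Combinatorics.Permutations"
begin

section \<open>The root system of type A\<close>

text \<open>
  Throughout, \<open>\<alpha> 1, \<dots>, \<alpha> n\<close> is meant to be a basis of the real vector space given by the
  type \<open>'v\<close>; the values of \<open>\<alpha>\<close> outside \<open>{1..n}\<close> play no role.
\<close>

abbreviation pts :: "nat \<Rightarrow> nat set" where
  "pts n \<equiv> {1..n + 1}"

definition simple_roots :: "nat \<Rightarrow> (nat \<Rightarrow> 'v::real_vector) \<Rightarrow> 'v set" where
  "simple_roots n \<alpha> = \<alpha> ` {1..n}"

definition pos_roots :: "nat \<Rightarrow> (nat \<Rightarrow> 'v::real_vector) \<Rightarrow> 'v set" where
  "pos_roots n \<alpha> = {\<Sum>l=i..k. \<alpha> l | i k. 1 \<le> i \<and> i \<le> k \<and> k \<le> n}"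

definition roots :: "nat \<Rightarrow> (nat \<Rightarrow> 'v::real_vector) \<Rightarrow> 'v set" where
  "roots n \<alpha> = pos_roots n \<alpha> \<union> uminus ` pos_roots n \<alpha>"

definition bform :: "nat \<Rightarrow> (nat \<Rightarrow> 'v::real_vector) \<Rightarrow> 'v \<Rightarrow> 'v \<Rightarrow> real" where
  "bform n \<alpha> u v =
     (\<Sum>i=1..n. \<Sum>j=1..n.
        representation (simple_roots n \<alpha>) u (\<alpha> i) * representation (simple_roots n \<alpha>) v (\<alpha> j) *
        (if i = j then 1 else if i = j + 1 \<or> j = i + 1 then - (1 / 2) else 0))"

definition root_ab :: "(nat \<Rightarrow> 'v::real_vector) \<Rightarrow> nat \<Rightarrow> nat \<Rightarrow> 'v" where
  "root_ab \<alpha> a b = (if a < b then \<Sum>l=a..<b. \<alpha> l else - (\<Sum>l=b..<a. \<alpha> l))"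

text \<open>The image of a set \<open>C\<close> of roots under the action of a permutation \<open>w\<close> of \<open>pts n\<close>.\<close>

definition act :: "nat \<Rightarrow> (nat \<Rightarrow> 'v::real_vector) \<Rightarrow> (nat \<Rightarrow> nat) \<Rightarrow> 'v set \<Rightarrow> 'v set" where
  "act n \<alpha> w C =
     {root_ab \<alpha> (w a) (w b) | a b. a \<in> pts n \<and> b \<in> pts n \<and> a \<noteq> b \<and> root_ab \<alpha> a b \<in> C}"

definition vector_space_total_order ::
    "('v::real_vector \<Rightarrow> 'v \<Rightarrow> bool) \<Rightarrow> ('v \<Rightarrow> 'v \<Rightarrow> bool) \<Rightarrow> bool" where
  "vector_space_total_order le lt \<longleftrightarrow>
     class.linorder le lt \<and>
     (\<forall>u v w. le u v \<longrightarrow> le (u + w) (v + w)) \<and>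
     (\<forall>c u v. 0 \<le> c \<longrightarrow> le u v \<longrightarrow> le (c *\<^sub>R u) (c *\<^sub>R v))"

definition positive_system :: "nat \<Rightarrow> (nat \<Rightarrow> 'v::real_vector) \<Rightarrow> 'v set \<Rightarrow> bool" where
  "positive_system n \<alpha> P \<longleftrightarrow>
     (\<exists>le lt. vector_space_total_order le lt \<and> P = {\<beta> \<in> roots n \<alpha>. lt 0 \<beta>})"

definition closed_roots :: "nat \<Rightarrow> (nat \<Rightarrow> 'v::real_vector) \<Rightarrow> 'v set \<Rightarrow> bool" where
  "closed_roots n \<alpha> C \<longleftrightarrow>
     C \<subseteq> roots n \<alpha> \<and> (\<forall>\<beta>\<in>C. \<forall>\<gamma>\<in>C. \<beta> + \<gamma> \<in> roots n \<alpha> \<longrightarrow> \<beta> + \<gamma> \<in> C)"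

definition biclosed :: "nat \<Rightarrow> (nat \<Rightarrow> 'v::real_vector) \<Rightarrow> 'v set \<Rightarrow> bool" where
  "biclosed n \<alpha> C \<longleftrightarrow> closed_roots n \<alpha> C \<and> closed_roots n \<alpha> (roots n \<alpha> - C)"

definition orthogonal_simple ::
    "nat \<Rightarrow> (nat \<Rightarrow> 'v::real_vector) \<Rightarrow> 'v set \<Rightarrow> 'v set \<Rightarrow> bool" where
  "orthogonal_simple n \<alpha> D1 D2 \<longleftrightarrow>
     D1 \<subseteq> simple_roots n \<alpha> \<and> D2 \<subseteq> simple_roots n \<alpha> \<and>
     (\<forall>\<beta>\<in>D1. \<forall>\<gamma>\<in>D2. bform n \<alpha> \<beta> \<gamma> = 0)"

definition Phi2 :: "nat \<Rightarrow> (nat \<Rightarrow> 'v::real_vector) \<Rightarrow> 'v set \<Rightarrow> 'v set \<Rightarrow> 'v set" where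
  "Phi2 n \<alpha> D1 D2 = (pos_roots n \<alpha> - span D1) \<union> (span D2 \<inter> roots n \<alpha>)"

definition parabolic :: "nat \<Rightarrow> (nat \<Rightarrow> 'v::real_vector) \<Rightarrow> 'v set \<Rightarrow> bool" where
  "parabolic n \<alpha> C \<longleftrightarrow>
     (\<exists>w D2. w permutes pts n \<and> D2 \<subseteq> simple_roots n \<alpha> \<and> C = act n \<alpha> w (Phi2 n \<alpha> {} D2))"

definition horocyclic :: "nat \<Rightarrow> (nat \<Rightarrow> 'v::real_vector) \<Rightarrow> 'v set \<Rightarrow> bool" where
  "horocyclic n \<alpha> C \<longleftrightarrow>
     (\<exists>w D1. w permutes pts n \<and> D1 \<subseteq> simple_roots n \<alpha> \<and> C = act n \<alpha> w (Phi2 n \<alpha> D1 {}))"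

section \<open>Quasitrivial semigroup structures\<close>

text \<open>
  A structure on \<open>X\<close> is a function on \<open>X \<times> X\<close> in the extensional sense (\<open>undefined\<close> outside
  \<open>X \<times> X\<close>), so that equality in HOL is equality of maps \<open>X \<times> X \<rightarrow> X\<close>.
\<close>

definition quasitrivial_semigroup :: "'a set \<Rightarrow> ('a \<times> 'a \<Rightarrow> 'a) \<Rightarrow> bool" where
  "quasitrivial_semigroup X F \<longleftrightarrow>
     F \<in> X \<times> X \<rightarrow>\<^sub>E X \<and>
     (\<forall>a\<in>X. \<forall>b\<in>X. \<forall>c\<in>X. F (F (a, b), c) = F (a, F (b, c))) \<and>
     (\<forall>a\<in>X. \<forall>b\<in>X. F (a, b) \<in> {a, b})"

definition commutative_on :: "'a set \<Rightarrow> ('a \<times> 'a \<Rightarrow> 'a) \<Rightarrow> bool" where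
  "commutative_on X F \<longleftrightarrow> (\<forall>a\<in>X. \<forall>b\<in>X. F (a, b) = F (b, a))"

definition anticommutative_on :: "'a set \<Rightarrow> ('a \<times> 'a \<Rightarrow> 'a) \<Rightarrow> bool" where
  "anticommutative_on X F \<longleftrightarrow> (\<forall>a\<in>X. \<forall>b\<in>X. F (a, b) = F (b, a) \<longrightarrow> a = b)"

definition has_identity_on :: "'a set \<Rightarrow> ('a \<times> 'a \<Rightarrow> 'a) \<Rightarrow> bool" where
  "has_identity_on X F \<longleftrightarrow> (\<exists>e\<in>X. \<forall>x\<in>X. F (e, x) = x \<and> F (x, e) = x)"

definition has_zero_on :: "'a set \<Rightarrow> ('a \<times> 'a \<Rightarrow> 'a) \<Rightarrow> bool" where
  "has_zero_on X F \<longleftrightarrow> (\<exists>z\<in>X. \<forall>x\<in>X. F (z, x) = z \<and> F (x, z) = z)"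

section \<open>The semigroup structure attached to a biclosed set\<close>

text \<open>
  The interval containing \<open>i\<close>: consecutive \<open>l\<close>, \<open>l + 1\<close> lie in the same interval iff \<open>\<alpha> l \<in> D\<close>,
  where \<open>D\<close> is the union of the two orthogonal sets of simple roots.
\<close>

definition interval_of :: "nat \<Rightarrow> (nat \<Rightarrow> 'v) \<Rightarrow> 'v set \<Rightarrow> nat \<Rightarrow> nat set" where
  "interval_of n \<alpha> D i = {j \<in> pts n. \<forall>l\<in>{min i j..<max i j}. \<alpha> l \<in> D}"

definition preorder_of ::
    "nat \<Rightarrow> (nat \<Rightarrow> 'v) \<Rightarrow> (nat \<Rightarrow> nat) \<Rightarrow> 'v set \<Rightarrow> nat \<Rightarrow> nat \<Rightarrow> bool" where
  "preorder_of n \<alpha> \<sigma> D x y \<longleftrightarrow>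
     interval_of n \<alpha> D (inv \<sigma> x) = interval_of n \<alpha> D (inv \<sigma> y) \<or> inv \<sigma> x < inv \<sigma> y"

definition interval_from :: "(nat \<Rightarrow> 'v) \<Rightarrow> 'v set \<Rightarrow> nat set \<Rightarrow> bool" where
  "interval_from \<alpha> D1 I \<longleftrightarrow> (\<forall>l. l \<in> I \<and> l + 1 \<in> I \<longrightarrow> \<alpha> l \<in> D1)"

text \<open>
  A one-element interval satisfies \<open>interval_from\<close> vacuously; this is harmless, since then
  \<open>x = y\<close> and both choices agree.
\<close>

definition semigroup_of ::
    "nat \<Rightarrow> (nat \<Rightarrow> 'v) \<Rightarrow> (nat \<Rightarrow> nat) \<Rightarrow> 'v set \<Rightarrow> 'v set \<Rightarrow> nat \<times> nat \<Rightarrow> nat" where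
  "semigroup_of n \<alpha> \<sigma> D1 D2 =
     restrict (\<lambda>(x, y).
       if \<not> preorder_of n \<alpha> \<sigma> (D1 \<union> D2) y x then y
       else if \<not> preorder_of n \<alpha> \<sigma> (D1 \<union> D2) x y then x
       else if interval_from \<alpha> D1 (interval_of n \<alpha> (D1 \<union> D2) (inv \<sigma> x)) then x
       else y) (pts n \<times> pts n)"

text \<open>The description operator is justified by independence of the presentation of \<open>C\<close>.\<close>

definition FC :: "nat \<Rightarrow> (nat \<Rightarrow> 'v::real_vector) \<Rightarrow> 'v set \<Rightarrow> nat \<times> nat \<Rightarrow> nat" where
  "FC n \<alpha> C = (THE F. \<exists>\<sigma> D1 D2. \<sigma> permutes pts n \<and> orthogonal_simple n \<alpha> D1 D2 \<and>
     C = act n \<alpha> \<sigma> (Phi2 n \<alpha> D1 D2) \<and> F = semigroup_of n \<alpha> \<sigma> D1 D2)"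

end

theory Submission imports Defs begin

text \<open>
  For \<open>x \<noteq> y\<close> one has \<open>F\<^sub>C(x, y) = y\<close> iff \<open>\<alpha>\<^sub>x\<^sub>,\<^sub>y \<in> C\<close>. Under this correspondence associativity of
  \<open>F\<^sub>C\<close> says that the relation \<open>\<alpha>\<^sub>x\<^sub>,\<^sub>y \<in> C\<close> and its complement are both transitive on triples of
  distinct points, which is biclosedness of \<open>C\<close>; so the bijection is immediate once \<open>F\<^sub>C\<close> is known to
  be defined, and every other claim is read off from the relation. That every biclosed set is of the
  form \<open>w \<Phi>\<^sup>+\<close> with parameters \<open>\<Delta>\<^sub>1, \<Delta>\<^sub>2\<close> follows by sorting the points so that
  \<open>\<alpha>\<^sub>b\<^sub>,\<^sub>a \<in> C\<close> implies \<open>\<alpha>\<^sub>a\<^sub>,\<^sub>b \<in> C\<close> for \<open>a < b\<close>: then the whole relation is determined by its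
  values on consecutive points.
\<close>

section \<open>Quasitrivial semigroups and binary relations\<close>

text \<open>On a pair x \<noteq> y, the operation is decided by two bits, whether the root from x to
  y and the root from y to x lie in C: neither gives the first projection, both give the second,
  exactly one gives a commutative operation. Parts (1), (2) and (4) thus become conditions on these
  bits, and an identity or a zero is a point related to all others in one fixed direction only.
  Triples are distinct because \<open>root_ab \<alpha> x x\<close> is 0, which is no root: a sum
  such as \<open>root_ab \<alpha> x y + root_ab \<alpha> y x\<close> puts no condition on a closed
  set. The obstacle is that the semigroup is given through a presentation of C, which is not unique.
  Rewriting it in terms of C alone settles independence without comparing two presentations. For
  positive systems an order of the points is not enough: a total order on the whole space has to be
  produced, and a lexicographic one is used.\<close>

definition bitrans_on :: "'a set \<Rightarrow> ('a \<Rightarrow> 'a \<Rightarrow> bool) \<Rightarrow> bool" where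
  "bitrans_on X R \<longleftrightarrow> (\<forall>x\<in>X. \<forall>y\<in>X. \<forall>z\<in>X. x \<noteq> y \<and> y \<noteq> z \<and> x \<noteq> z \<longrightarrow>
     (R x y \<longrightarrow> R y z \<longrightarrow> R x z) \<and> (\<not> R x y \<longrightarrow> \<not> R y z \<longrightarrow> \<not> R x z))"

definition select_op :: "'a set \<Rightarrow> ('a \<Rightarrow> 'a \<Rightarrow> bool) \<Rightarrow> 'a \<times> 'a \<Rightarrow> 'a" where
  "select_op X R = restrict (\<lambda>(x, y). if R x y then y else x) (X \<times> X)"

lemma bitrans_onD:
  assumes "bitrans_on X R" "x \<in> X" "y \<in> X" "z \<in> X" "x \<noteq> y" "y \<noteq> z" "x \<noteq> z"
  shows "R x y \<Longrightarrow> R y z \<Longrightarrow> R x z" and "\<not> R x y \<Longrightarrow> \<not> R y z \<Longrightarrow> \<not> R x z"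
  using assms(1)[unfolded bitrans_on_def, rule_format, OF assms(2-4)] assms(5-7) by blast+

text \<open>Complementing exchanges the two halves of the condition; taking the converse as well
  preserves sortedness, so that facts proved for \<open>D1\<close> can be reused for
  \<open>D2\<close>.\<close>

lemma bitrans_on_dual:
  assumes "bitrans_on X R"
  shows "bitrans_on X (\<lambda>x y. \<not> R y x)"
  unfolding bitrans_on_def
proof (intro ballI impI)
  fix x y z assume "x \<in> X" "y \<in> X" "z \<in> X" "x \<noteq> y \<and> y \<noteq> z \<and> x \<noteq> z"
  then show "(\<not> R y x \<longrightarrow> \<not> R z y \<longrightarrow> \<not> R z x) \<and> (\<not> \<not> R y x \<longrightarrow> \<not> \<not> R z y \<longrightarrow> \<not> \<not> R z x)"
    using bitrans_onD[OF assms, of z y x] by auto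
qed

lemma bitrans_on_cong:
  assumes "\<And>x y. x \<in> X \<Longrightarrow> y \<in> X \<Longrightarrow> x \<noteq> y \<Longrightarrow> R x y = S x y"
  shows "bitrans_on X R = bitrans_on X S"
  unfolding bitrans_on_def by (intro ball_cong refl imp_cong) (simp add: assms)

lemma bitrans_on_reindex:
  assumes "w permutes X"
  shows "bitrans_on X (\<lambda>x y. R (w x) (w y)) = bitrans_on X R"
proof
  assume *: "bitrans_on X R"
  show "bitrans_on X (\<lambda>x y. R (w x) (w y))"
    unfolding bitrans_on_def
    using bitrans_onD[OF *] permutes_in_image[OF assms] permutes_inj[OF assms]
    by (metis injD)
next
  assume *: "bitrans_on X (\<lambda>x y. R (w x) (w y))"
  show "bitrans_on X R"
    unfolding bitrans_on_def
  proof (intro ballI impI)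
    fix x y z assume h: "x \<in> X" "y \<in> X" "z \<in> X" "x \<noteq> y \<and> y \<noteq> z \<and> x \<noteq> z"
    have i: "inv w u \<in> X" if "u \<in> X" for u
      using that permutes_inv[OF assms] permutes_in_image by metis
    have e: "w (inv w u) = u" for u
      using permutes_inverses(1)[OF assms] .
    have "inv w x \<noteq> inv w y" "inv w y \<noteq> inv w z" "inv w x \<noteq> inv w z"
      using h e by metis+
    then show "(R x y \<longrightarrow> R y z \<longrightarrow> R x z) \<and> (\<not> R x y \<longrightarrow> \<not> R y z \<longrightarrow> \<not> R x z)"
      using bitrans_onD[OF * i[OF h(1)] i[OF h(2)] i[OF h(3)]] by (simp add: e)
  qed
qed

lemma select_op_apply [simp]:
  "x \<in> X \<Longrightarrow> y \<in> X \<Longrightarrow> select_op X R (x, y) = (if R x y then y else x)"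
  by (simp add: select_op_def)

lemma select_op_eq_iff:
  "select_op X R = select_op X S \<longleftrightarrow> (\<forall>x\<in>X. \<forall>y\<in>X. x \<noteq> y \<longrightarrow> R x y = S x y)"
proof
  assume *: "select_op X R = select_op X S"
  show "\<forall>x\<in>X. \<forall>y\<in>X. x \<noteq> y \<longrightarrow> R x y = S x y"
  proof (intro ballI impI)
    fix x y assume "x \<in> X" "y \<in> X" "x \<noteq> y"
    then show "R x y = S x y" using fun_cong[OF *, of "(x, y)"] by (auto split: if_splits)
  qed
qed (auto simp: select_op_def fun_eq_iff)

text \<open>For distinct x, y, z the two bracketings can differ only if \<open>R x y\<close> and
  \<open>R y z\<close> have the same truth value, and their equality is then exactly the
  corresponding half of bitransitivity. If two arguments coincide, associativity is
  automatic.\<close>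

lemma quasitrivial_semigroup_select_op:
  "quasitrivial_semigroup X (select_op X R) \<longleftrightarrow> bitrans_on X R"
proof
  assume q: "quasitrivial_semigroup X (select_op X R)"
  show "bitrans_on X R"
    unfolding bitrans_on_def
  proof (intro ballI impI)
    fix x y z assume h: "x \<in> X" "y \<in> X" "z \<in> X" "x \<noteq> y \<and> y \<noteq> z \<and> x \<noteq> z"
    then have "select_op X R (select_op X R (x, y), z) = select_op X R (x, select_op X R (y, z))"
      using q unfolding quasitrivial_semigroup_def by blast
    with h show "(R x y \<longrightarrow> R y z \<longrightarrow> R x z) \<and> (\<not> R x y \<longrightarrow> \<not> R y z \<longrightarrow> \<not> R x z)"
      by (auto split: if_splits)
  qed
next
  assume b: "bitrans_on X R"
  have "select_op X R (select_op X R (x, y), z) = select_op X R (x, select_op X R (y, z))"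
    if h: "x \<in> X" "y \<in> X" "z \<in> X" for x y z
  proof (cases "x = y \<or> y = z \<or> x = z")
    case True
    then show ?thesis using h by auto
  next
    case False
    then have "R x y \<longrightarrow> R y z \<longrightarrow> R x z" "\<not> R x y \<longrightarrow> \<not> R y z \<longrightarrow> \<not> R x z"
      using b h unfolding bitrans_on_def by blast+
    then show ?thesis using h by simp
  qed
  moreover have "select_op X R \<in> X \<times> X \<rightarrow>\<^sub>E X"
    by (auto simp: select_op_def)
  ultimately show "quasitrivial_semigroup X (select_op X R)"
    unfolding quasitrivial_semigroup_def by auto
qed

lemma quasitrivial_semigroup_eq_select_op:
  assumes "quasitrivial_semigroup X F"
  shows "F = select_op X (\<lambda>x y. F (x, y) = y)"
proof
  fix p
  show "F p = select_op X (\<lambda>x y. F (x, y) = y) p"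
  proof (cases "p \<in> X \<times> X")
    case True
    then obtain x y where p: "p = (x, y)" "x \<in> X" "y \<in> X" by auto
    then have "F (x, y) \<in> {x, y}" using assms unfolding quasitrivial_semigroup_def by blast
    then show ?thesis using p by auto
  next
    case False
    moreover have "F \<in> X \<times> X \<rightarrow>\<^sub>E X"
      using assms unfolding quasitrivial_semigroup_def by blast
    \<comment> \<open>Off \<open>X \<times> X\<close> both functions take the default value, so they
      agree as HOL functions.\<close>
    ultimately have "F p = undefined" by (intro PiE_arb)
    then show ?thesis using False by (simp add: select_op_def)
  qed
qed

lemma commutative_select_op:
  "commutative_on X (select_op X R) \<longleftrightarrow> (\<forall>x\<in>X. \<forall>y\<in>X. x \<noteq> y \<longrightarrow> R x y = (\<not> R y x))"
  unfolding commutative_on_def by auto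

lemma anticommutative_select_op:
  "anticommutative_on X (select_op X R) \<longleftrightarrow> (\<forall>x\<in>X. \<forall>y\<in>X. x \<noteq> y \<longrightarrow> R x y = R y x)"
  unfolding anticommutative_on_def by auto

lemma has_identity_select_op:
  "has_identity_on X (select_op X R) \<longleftrightarrow> (\<exists>e\<in>X. \<forall>x\<in>X. x \<noteq> e \<longrightarrow> R e x \<and> \<not> R x e)"
  unfolding has_identity_on_def by (intro bex_cong refl) auto

lemma has_zero_select_op:
  "has_zero_on X (select_op X R) \<longleftrightarrow> (\<exists>e\<in>X. \<forall>x\<in>X. x \<noteq> e \<longrightarrow> R x e \<and> \<not> R e x)"
  unfolding has_zero_on_def by (intro bex_cong refl) auto

lemma restrict_pair_eq_iff:
  "restrict F ({x, y} \<times> {x, y}) = restrict G ({x, y} \<times> {x, y}) \<longleftrightarrow>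
     F (x, x) = G (x, x) \<and> F (x, y) = G (x, y) \<and> F (y, x) = G (y, x) \<and> F (y, y) = G (y, y)"
proof
  assume h: "restrict F ({x, y} \<times> {x, y}) = restrict G ({x, y} \<times> {x, y})"
  show "F (x, x) = G (x, x) \<and> F (x, y) = G (x, y) \<and> F (y, x) = G (y, x) \<and> F (y, y) = G (y, y)"
    using fun_cong[OF h, of "(x, x)"] fun_cong[OF h, of "(x, y)"]
      fun_cong[OF h, of "(y, x)"] fun_cong[OF h, of "(y, y)"] by simp
qed (auto simp: restrict_def fun_eq_iff)

lemma bij_betw_sub:
  assumes "bij_betw f A B" "A' \<subseteq> A" "\<And>x. x \<in> A \<Longrightarrow> x \<in> A' \<longleftrightarrow> P (f x)"
  shows "bij_betw f A' {y. y \<in> B \<and> P y}"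
proof -
  have "f ` A' = {y. y \<in> B \<and> P y}"
    using assms(2,3) bij_betw_imp_surj_on[OF assms(1)] by blast
  then show ?thesis
    using inj_on_subset[OF bij_betw_imp_inj_on[OF assms(1)] assms(2)] by (simp add: bij_betw_def)
qed

section \<open>Sorting\<close>

lemma ex_permutation_sorting:
  fixes r :: "nat \<Rightarrow> nat"
  shows "\<exists>\<sigma>. \<sigma> permutes pts n \<and> (\<forall>a\<in>pts n. \<forall>b\<in>pts n. a < b \<longrightarrow> r (\<sigma> a) \<le> r (\<sigma> b))"
proof -
  define xs where "xs = sort_key r [1..<n + 2]"
  have len: "length xs = n + 1" and set: "set xs = pts n" and dist: "distinct xs"
    by (auto simp: xs_def)
  \<comment> \<open>List positions start at 0 and points at 1, hence the shift. The identity outside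
    \<open>pts n\<close> is part of being a permutation of \<open>pts n\<close>.\<close>
  define \<sigma> where "\<sigma> i = (if i \<in> pts n then xs ! (i - 1) else i)" for i
  have "\<sigma> ` pts n = pts n"
  proof -
    have "xs ! (i - 1) \<in> pts n" if "i \<in> pts n" for i
      using that nth_mem[of "i - 1" xs] len set by auto
    moreover have "\<exists>i\<in>pts n. y = xs ! (i - 1)" if y: "y \<in> pts n" for y
    proof -
      obtain j where "j < length xs" "xs ! j = y" using y set by (metis in_set_conv_nth)
      then show ?thesis using len by (intro bexI[of _ "j + 1"]) auto
    qed
    ultimately show ?thesis by (auto simp: \<sigma>_def image_def)
  qed
  then have "\<sigma> permutes pts n"
    by (intro bij_imp_permutes) (auto simp: bij_betw_def \<sigma>_def eq_card_imp_inj_on)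
  moreover have "r (\<sigma> a) \<le> r (\<sigma> b)" if "a \<in> pts n" "b \<in> pts n" "a < b" for a b
  proof -
    have "sorted (map r xs)" by (simp add: xs_def)
    then show ?thesis
      using that len sorted_nth_mono[of "map r xs" "a - 1" "b - 1"] by (simp add: \<sigma>_def)
  qed
  ultimately show ?thesis by blast
qed

text \<open>The strict relation \<open>R x y \<and> \<not> R y x\<close> is a strict partial order; sort by the number of
  its predecessors.\<close>

lemma bitrans_on_sorting:
  assumes b: "bitrans_on (pts n) R"
  obtains \<sigma> where "\<sigma> permutes pts n"
    "\<And>a b. a \<in> pts n \<Longrightarrow> b \<in> pts n \<Longrightarrow> a < b \<Longrightarrow> R (\<sigma> b) (\<sigma> a) \<Longrightarrow> R (\<sigma> a) (\<sigma> b)"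
proof -
  define T where "T x y \<longleftrightarrow> R x y \<and> \<not> R y x" for x y
  define r where "r x = card {y \<in> pts n. T y x}" for x
  \<comment> \<open>Closedness along x, y, z gives \<open>R x z\<close>; coclosedness along z, y, x
    gives \<open>\<not> R z x\<close>.\<close>
  have trans: "T x z" if "T x y" "T y z" "x \<in> pts n" "y \<in> pts n" "z \<in> pts n" for x y z
    using that bitrans_onD[OF b, of x y z] bitrans_onD[OF b, of z y x] unfolding T_def by metis
  have r_less: "r x < r y" if "T x y" "x \<in> pts n" "y \<in> pts n" for x y
  proof -
    have "x \<in> {z \<in> pts n. T z y}" "x \<notin> {z \<in> pts n. T z x}" using that by (auto simp: T_def)
    moreover have "{z \<in> pts n. T z x} \<subseteq> {z \<in> pts n. T z y}" using trans that by blast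
    ultimately show ?thesis unfolding r_def by (intro psubset_card_mono) auto
  qed
  obtain \<sigma> where s: "\<sigma> permutes pts n" "\<forall>a\<in>pts n. \<forall>b\<in>pts n. a < b \<longrightarrow> r (\<sigma> a) \<le> r (\<sigma> b)"
    using ex_permutation_sorting by blast
  have "R (\<sigma> a) (\<sigma> b)" if "a \<in> pts n" "b \<in> pts n" "a < b" "R (\<sigma> b) (\<sigma> a)" for a b
    using r_less[of "\<sigma> b" "\<sigma> a"] s(2) that permutes_in_image[OF s(1)] unfolding T_def
    by (metis leD)
  then show ?thesis using that s(1) by blast
qed

text \<open>Induction on the gap, splitting off the last point: for sorted \<open>S\<close>, the
  absence of a relation across a gap is the conjunction of its absence across the two parts. Applied
  to the converse complement, the same statement describes the relations from larger to smaller
  points.\<close>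

lemma sorted_bitrans_gap:
  assumes b: "bitrans_on (pts n) S"
    and sort: "\<And>a b. a \<in> pts n \<Longrightarrow> b \<in> pts n \<Longrightarrow> a < b \<Longrightarrow> S b a \<Longrightarrow> S a b"
    and "a \<in> pts n" "b \<in> pts n" "a < b"
  shows "\<not> S a b \<longleftrightarrow> (\<forall>l\<in>{a..<b}. \<not> S l (l + 1))"
proof -
  have "a + k + 1 \<in> pts n \<Longrightarrow> \<not> S a (a + k + 1) \<longleftrightarrow> (\<forall>l\<in>{a..<a + k + 1}. \<not> S l (l + 1))" for k
  proof (induction k)
    case 0
    then show ?case by simp
  next
    case (Suc k)
    let ?c = "a + k + 1" and ?d = "a + Suc k + 1"
    have pts: "a \<in> pts n" "?c \<in> pts n" "?d \<in> pts n" using Suc.prems assms(3) by auto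
    have "\<not> S a ?d \<longleftrightarrow> \<not> S a ?c \<and> \<not> S ?c ?d"
    proof
      assume ad: "\<not> S a ?d"
      have ac: "\<not> S a ?c"
      proof
        assume ac: "S a ?c"
        then have "\<not> S ?c ?d" using bitrans_onD(1)[OF b pts] ad by auto
        \<comment> \<open>Sorting reverses the failing step, so that \<open>a\<close>,
          \<open>?d\<close>, \<open>?c\<close> becomes a path of two unrelated steps and
          coclosedness contradicts \<open>S a ?c\<close>.\<close>
        then have "\<not> S ?d ?c" using sort[OF pts(2,3)] by auto
        then show False using bitrans_onD(2)[OF b pts(1,3,2)] ad ac by auto
      qed
      then have "\<not> S ?c a" using sort[OF pts(1,2)] by auto
      then show "\<not> S a ?c \<and> \<not> S ?c ?d" using ac bitrans_onD(2)[OF b pts(2,1,3)] ad by auto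
    next
      assume "\<not> S a ?c \<and> \<not> S ?c ?d"
      then show "\<not> S a ?d" using bitrans_onD(2)[OF b pts] by auto
    qed
    also have "\<dots> \<longleftrightarrow> (\<forall>l\<in>{a..<?d}. \<not> S l (l + 1))"
      using Suc.IH pts(2) by (auto simp: less_Suc_eq)
    finally show ?case .
  qed
  from this[of "b - a - 1"] show ?thesis using assms(4,5) by auto
qed

text \<open>\<open>P\<close> and \<open>Q\<close> stand for membership of a simple root in
  \<open>D1\<close> and in \<open>D2\<close>. Orthogonality forbids a change of label between
  neighbours, so one label holds throughout a linked stretch.\<close>

lemma linked_blocks_uniform:
  fixes p q k :: nat
  assumes link: "\<And>l. p \<le> l \<Longrightarrow> l < q \<Longrightarrow> P l \<or> Q l"
    and disj: "\<And>l. p \<le> l \<Longrightarrow> l < q \<Longrightarrow> \<not> (P l \<and> Q l)"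
    and adj: "\<And>l. p \<le> l \<Longrightarrow> l + 1 < q \<Longrightarrow> \<not> (P l \<and> Q (l + 1)) \<and> \<not> (Q l \<and> P (l + 1))"
    and k: "p \<le> k" "k < q" "Q k" and l: "p \<le> l" "l < q"
  shows "Q l"
proof -
  have step: "Q l = Q (l + 1)" if "p \<le> l" "l + 1 < q" for l
    using that link[of l] link[of "l + 1"] adj[of l] by auto
  have "p + i < q \<Longrightarrow> Q p = Q (p + i)" for i
    by (induction i) (use step in auto)
  from this[of "k - p"] this[of "l - p"] k l show ?thesis by auto
qed

section \<open>Roots and biclosed sets\<close>

locale type_A_basis =
  fixes n :: nat and \<alpha> :: "nat \<Rightarrow> 'v::real_vector"
  assumes n_pos: "n \<ge> 1" and inj: "inj_on \<alpha> {1..n}"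
    and indep: "independent (\<alpha> ` {1..n})" and span_eq: "span (\<alpha> ` {1..n}) = UNIV"
begin

abbreviation "rel C x y \<equiv> root_ab \<alpha> x y \<in> C"

text \<open>The value 0 at the indices 0 and \<open>n + 1\<close> lets the differences of
  consecutive coordinates be formed uniformly at all points, including the two end points.\<close>

definition crd :: "nat \<Rightarrow> 'v \<Rightarrow> real" where
  "crd i v = (if i \<in> {1..n} then representation (simple_roots n \<alpha>) v (\<alpha> i) else 0)"

text \<open>The coordinates in which \<open>root_ab \<alpha> a b\<close> is \<open>\<epsilon>\<^sub>a - \<epsilon>\<^sub>b\<close>.\<close>

definition eps :: "nat \<Rightarrow> 'v \<Rightarrow> real" where
  "eps i v = crd i v - crd (i - 1) v"

lemma indep': "independent (simple_roots n \<alpha>)" and span_eq': "span (simple_roots n \<alpha>) = UNIV"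
  using indep span_eq by (simp_all add: simple_roots_def)

lemma linear_crd: "linear (crd i)"
proof (rule linearI)
  show "crd i (u + v) = crd i u + crd i v" for u v
    using representation_add[OF indep', of u v] span_eq' by (simp add: crd_def add.commute)
  show "crd i (c *\<^sub>R u) = c *\<^sub>R crd i u" for c u
    using representation_scale[OF indep', of u c] span_eq' by (simp add: crd_def)
qed

lemma linear_eps: "linear (eps i)"
  unfolding eps_def by (rule linear_compose_sub[OF linear_crd linear_crd])

lemma crd_simple: "j \<in> {1..n} \<Longrightarrow> crd i (\<alpha> j) = of_bool (i = j)"
proof -
  assume j: "j \<in> {1..n}"
  then have "\<alpha> j \<in> simple_roots n \<alpha>" by (simp add: simple_roots_def)
  then have "representation (simple_roots n \<alpha>) (\<alpha> j) = (\<lambda>v. if v = \<alpha> j then 1 else 0)"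
    by (rule representation_basis[OF indep'])
  then show ?thesis using j inj_onD[OF inj, of i j] by (auto simp: crd_def)
qed

text \<open>Differences of prefix sums remove the case distinction on the order of \<open>a\<close>
  and \<open>b\<close>, and turn additivity along a path into telescoping.\<close>

lemma root_ab_eq: 
  assumes "a \<ge> 1" "b \<ge> 1"
  shows "root_ab \<alpha> a b = sum \<alpha> {1..<b} - sum \<alpha> {1..<a}"
proof (cases "a < b")
  case True
  then show ?thesis using assms sum.atLeastLessThan_concat[of 1 a b \<alpha>]
    by (simp add: root_ab_def algebra_simps)
next
  case False
  then show ?thesis using assms sum.atLeastLessThan_concat[of 1 b a \<alpha>]
    by (simp add: root_ab_def algebra_simps)
qed

section \<open>Coordinates of roots, and sums of two roots\<close>

lemma crd_root_ab:
  assumes "a \<in> pts n" "b \<in> pts n"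
  shows "crd i (root_ab \<alpha> a b) = of_bool (1 \<le> i \<and> i < b) - of_bool (1 \<le> i \<and> i < a)"
proof -
  have "crd i (sum \<alpha> {1..<c}) = of_bool (1 \<le> i \<and> i < c)" if "c \<in> pts n" for c
  proof -
    have "crd i (sum \<alpha> {1..<c}) = (\<Sum>j\<in>{1..<c}. crd i (\<alpha> j))"
      by (rule linear_sum[OF linear_crd])
    also have "\<dots> = (\<Sum>j\<in>{1..<c}. if i = j then 1 else 0)"
      by (intro sum.cong refl) (use that in \<open>simp add: crd_simple\<close>)
    finally show ?thesis by simp
  qed
  then show ?thesis using assms by (simp add: root_ab_eq linear_diff[OF linear_crd])
qed

lemma eps_root_ab:
  assumes "a \<in> pts n" "b \<in> pts n" "i \<in> pts n"
  shows "eps i (root_ab \<alpha> a b) = of_bool (i = a) - of_bool (i = b)"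
proof -
  have "eps i (root_ab \<alpha> a b) = (of_bool (i < b) - of_bool (i < a))
      - (of_bool (1 \<le> i - 1 \<and> i - 1 < b) - of_bool (1 \<le> i - 1 \<and> i - 1 < a))"
    using assms(3) unfolding eps_def crd_root_ab[OF assms(1,2)] by simp
  \<comment> \<open>The boundary term \<open>of_bool (i = 1)\<close>, due to truncated subtraction
    at 0, is the same for \<open>a\<close> and \<open>b\<close> and cancels.\<close>
  moreover have "of_bool (i < c) - of_bool (1 \<le> i - 1 \<and> i - 1 < c) =
      (of_bool (i = 1) - of_bool (i = c) :: real)" if "c \<in> pts n" for c
    using that assms(3) by (cases "i = 1"; cases i c rule: linorder_cases) auto
  note this[OF assms(1)] this[OF assms(2)]
  ultimately show ?thesis by linarith
qed

text \<open>The basis coordinates are the partial sums of the \<open>eps\<close> coordinates. This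
  separation property later makes the lexicographic order total.\<close>

lemma eps_eqI:
  assumes "\<And>i. i \<in> pts n \<Longrightarrow> eps i u = eps i v"
  shows "u = v"
proof -
  have crd: "crd i u = crd i v" if "i \<le> n" for i
    using that
  proof (induction i)
    case 0
    then show ?case by (simp add: crd_def)
  next
    case (Suc i)
    then show ?case using assms[of "Suc i"] by (simp add: eps_def)
  qed
  have "representation (simple_roots n \<alpha>) u b = representation (simple_roots n \<alpha>) v b" for b
  proof (cases "b \<in> simple_roots n \<alpha>")
    case True
    then obtain i where "i \<in> {1..n}" "b = \<alpha> i" by (auto simp: simple_roots_def)
    then show ?thesis using crd[of i] by (simp add: crd_def)
  next
    case False
    then show ?thesis using representation_ne_zero by metis
  qed
  then show ?thesis
    using representation_eqI sum_nonzero_representation_eq[OF indep'] span_eq'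
    by (metis (no_types, lifting) ext UNIV_I)
qed

lemma root_ab_inj:
  assumes "a \<in> pts n" "b \<in> pts n" "c \<in> pts n" "d \<in> pts n" "a \<noteq> b"
    and "root_ab \<alpha> a b = root_ab \<alpha> c d"
  shows "a = c \<and> b = d"
proof -
  have "of_bool (i = a) - of_bool (i = b) = (of_bool (i = c) - of_bool (i = d) :: real)"
    if "i \<in> pts n" for i
    using assms eps_root_ab that by metis
  from this[of a] this[of b] show ?thesis using assms by (auto split: if_splits simp: of_bool_def)
qed

text \<open>A sum of two difference vectors has a single 1 and a single -1 only if the end of one
  cancels against the start of the other, so roots add up to a root only head to tail.\<close>

lemma root_ab_sum:
  assumes "a \<in> pts n" "b \<in> pts n" "c \<in> pts n" "d \<in> pts n" "e \<in> pts n" "f \<in> pts n"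
    and "a \<noteq> b" "c \<noteq> d" "e \<noteq> f"
    and "root_ab \<alpha> a b + root_ab \<alpha> c d = root_ab \<alpha> e f"
  shows "(b = c \<and> a = e \<and> d = f) \<or> (a = d \<and> c = e \<and> b = f)"
proof -
  have *: "(of_bool (i = a) - of_bool (i = b)) + (of_bool (i = c) - of_bool (i = d))
      = (of_bool (i = e) - of_bool (i = f) :: int)"
    if "i \<in> pts n" for i
  proof -
    have "real_of_int ((of_bool (i = a) - of_bool (i = b)) + (of_bool (i = c) - of_bool (i = d)))
        = real_of_int (of_bool (i = e) - of_bool (i = f))"
      using arg_cong[OF assms(10), of "eps i"] assms(1-6) that
      by (simp only: linear_add[OF linear_eps] eps_root_ab of_int_add of_int_diff of_int_of_bool)
    then show ?thesis by (simp only: of_int_eq_iff)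
  qed
  \<comment> \<open>At index \<open>a\<close> the left side is at least 1 unless
    \<open>a = d\<close>, and the right side reaches 1 only for \<open>a = e\<close>.\<close>
  consider "a = d" | "a = e" "a \<noteq> d"
    using *[OF assms(1)] assms(7-9) by (auto simp: of_bool_def split: if_splits)
  then show ?thesis
  proof cases
    case 1
    then show ?thesis using *[OF assms(2)] *[OF assms(3)] *[OF assms(5)] assms(7-9)
      by (auto simp: of_bool_def split: if_splits)
  next
    case 2
    then show ?thesis using *[OF assms(4)] *[OF assms(3)] assms(7-9)
      by (auto simp: of_bool_def split: if_splits)
  qed
qed

lemma root_ab_add:
  "a \<in> pts n \<Longrightarrow> b \<in> pts n \<Longrightarrow> c \<in> pts n \<Longrightarrow> root_ab \<alpha> a b + root_ab \<alpha> b c = root_ab \<alpha> a c"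
  by (simp add: root_ab_eq)

lemma root_ab_swap: "root_ab \<alpha> b a = - root_ab \<alpha> a b"
  by (auto simp: root_ab_def)

lemma pos_roots_eq: "pos_roots n \<alpha> = {root_ab \<alpha> a b | a b. a \<in> pts n \<and> b \<in> pts n \<and> a < b}"
proof -
  have "(\<exists>i k. x = sum \<alpha> {i..k} \<and> 1 \<le> i \<and> i \<le> k \<and> k \<le> n) \<longleftrightarrow>
      (\<exists>a b. x = root_ab \<alpha> a b \<and> a \<in> pts n \<and> b \<in> pts n \<and> a < b)" (is "?L \<longleftrightarrow> ?R") for x
  proof
    assume ?L
    then obtain i k where "x = sum \<alpha> {i..k}" "1 \<le> i" "i \<le> k" "k \<le> n" by blast
    then show ?R
      by (intro exI[of _ i] exI[of _ "k + 1"]) (auto simp: root_ab_def atLeastLessThanSuc_atLeastAtMost)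
  next
    assume ?R
    then obtain a b where "x = root_ab \<alpha> a b" "a \<in> pts n" "b \<in> pts n" "a < b" by blast
    then show ?L
      by (intro exI[of _ a] exI[of _ "b - 1"])
        (auto simp: root_ab_def atLeastLessThanSuc_atLeastAtMost[symmetric])
  qed
  then show ?thesis by (simp add: pos_roots_def)
qed

lemma roots_eq: "roots n \<alpha> = {root_ab \<alpha> a b | a b. a \<in> pts n \<and> b \<in> pts n \<and> a \<noteq> b}"
proof
  show "roots n \<alpha> \<subseteq> {root_ab \<alpha> a b | a b. a \<in> pts n \<and> b \<in> pts n \<and> a \<noteq> b}"
  proof
    fix v assume "v \<in> roots n \<alpha>"
    then obtain a b where ab: "a \<in> pts n" "b \<in> pts n" "a < b"
      and "v = root_ab \<alpha> a b \<or> v = - root_ab \<alpha> a b"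
      unfolding roots_def pos_roots_eq by blast
    then have "v = root_ab \<alpha> a b \<or> v = root_ab \<alpha> b a" by (simp only: root_ab_swap[of b a])
    moreover have "a \<noteq> b" "b \<noteq> a" using ab by auto
    ultimately show "v \<in> {root_ab \<alpha> a b | a b. a \<in> pts n \<and> b \<in> pts n \<and> a \<noteq> b}"
      using ab(1,2) by blast
  qed
  show "{root_ab \<alpha> a b | a b. a \<in> pts n \<and> b \<in> pts n \<and> a \<noteq> b} \<subseteq> roots n \<alpha>"
  proof clarify
    fix a b assume h: "a \<in> pts n" "b \<in> pts n" "a \<noteq> b"
    show "root_ab \<alpha> a b \<in> roots n \<alpha>"
    proof (cases "a < b")
      case True
      then show ?thesis using h unfolding roots_def pos_roots_eq by blast
    next
      case False
      then have "b < a" using h(3) by simp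
      then have "root_ab \<alpha> b a \<in> pos_roots n \<alpha>" using h unfolding pos_roots_eq by blast
      then have "- root_ab \<alpha> b a \<in> roots n \<alpha>" unfolding roots_def by (intro UnI2 imageI)
      then show ?thesis by (simp only: root_ab_swap[of a b])
    qed
  qed
qed

lemma root_ab_in_roots:
  "a \<in> pts n \<Longrightarrow> b \<in> pts n \<Longrightarrow> root_ab \<alpha> a b \<in> roots n \<alpha> \<longleftrightarrow> a \<noteq> b"
proof -
  assume h: "a \<in> pts n" "b \<in> pts n"
  have "root_ab \<alpha> a a \<noteq> root_ab \<alpha> c d" if "c \<in> pts n" "d \<in> pts n" "c \<noteq> d" for c d
    using root_ab_inj[OF that(1,2) h(1,1) that(3)] that(3) by metis
  then show ?thesis using h unfolding roots_eq by blast
qed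

lemma root_ab_in_pos_roots:
  assumes "a \<in> pts n" "b \<in> pts n"
  shows "root_ab \<alpha> a b \<in> pos_roots n \<alpha> \<longleftrightarrow> a < b"
proof
  assume "root_ab \<alpha> a b \<in> pos_roots n \<alpha>"
  then obtain c d where "root_ab \<alpha> c d = root_ab \<alpha> a b" "c \<in> pts n" "d \<in> pts n" "c < d"
    unfolding pos_roots_eq by auto
  then show "a < b" using root_ab_inj[of c d a b] assms by auto
qed (use assms pos_roots_eq in blast)

section \<open>Closed and biclosed sets as relations on the points\<close>

lemma roots_subset_eqI:
  assumes "C \<subseteq> roots n \<alpha>" "C' \<subseteq> roots n \<alpha>"
    and "\<And>x y. x \<in> pts n \<Longrightarrow> y \<in> pts n \<Longrightarrow> x \<noteq> y \<Longrightarrow> rel C x y = rel C' x y"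
  shows "C = C'"
  using assms unfolding roots_eq by blast

text \<open>By \<open>root_ab_sum\<close>, only head-to-tail pairs of roots are constrained by
  closedness, and \<open>root_ab_add\<close> identifies their sum.\<close>

lemma closed_roots_iff:
  "closed_roots n \<alpha> C \<longleftrightarrow> C \<subseteq> roots n \<alpha> \<and>
     (\<forall>x\<in>pts n. \<forall>y\<in>pts n. \<forall>z\<in>pts n. x \<noteq> y \<and> y \<noteq> z \<and> x \<noteq> z \<longrightarrow>
        rel C x y \<longrightarrow> rel C y z \<longrightarrow> rel C x z)" (is "?L \<longleftrightarrow> ?R")
proof
  assume L: ?L
  show ?R
  proof (intro conjI ballI impI)
    show "C \<subseteq> roots n \<alpha>" using L by (simp add: closed_roots_def)
    fix x y z assume "x \<in> pts n" "y \<in> pts n" "z \<in> pts n" "x \<noteq> y \<and> y \<noteq> z \<and> x \<noteq> z"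
      "rel C x y" "rel C y z"
    then show "rel C x z"
      using L root_ab_add[of x y z] root_ab_in_roots[of x z] unfolding closed_roots_def by metis
  qed
next
  assume R: ?R
  show ?L
    unfolding closed_roots_def
  proof (intro conjI ballI impI)
    show "C \<subseteq> roots n \<alpha>" using R by simp
    fix \<beta> \<gamma> assume h: "\<beta> \<in> C" "\<gamma> \<in> C" "\<beta> + \<gamma> \<in> roots n \<alpha>"
    obtain a b where ab: "\<beta> = root_ab \<alpha> a b" "a \<in> pts n" "b \<in> pts n" "a \<noteq> b"
      using h R unfolding roots_eq by blast
    obtain c d where cd: "\<gamma> = root_ab \<alpha> c d" "c \<in> pts n" "d \<in> pts n" "c \<noteq> d"
      using h R unfolding roots_eq by blast
    obtain e f where ef: "\<beta> + \<gamma> = root_ab \<alpha> e f" "e \<in> pts n" "f \<in> pts n" "e \<noteq> f"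
      using h(3) unfolding roots_eq by blast
    have "(b = c \<and> a = e \<and> d = f) \<or> (a = d \<and> c = e \<and> b = f)"
      using root_ab_sum[of a b c d e f] ab cd ef by simp
    then show "\<beta> + \<gamma> \<in> C"
      unfolding ef(1) using R h(1,2) ab cd ef(2-4) by metis
  qed
qed

lemma biclosed_iff: "biclosed n \<alpha> C \<longleftrightarrow> C \<subseteq> roots n \<alpha> \<and> bitrans_on (pts n) (rel C)"
proof -
  have "rel (roots n \<alpha> - C) x y \<longleftrightarrow> \<not> rel C x y" if "x \<in> pts n" "y \<in> pts n" "x \<noteq> y" for x y
    using that root_ab_in_roots by auto
  then show ?thesis
    unfolding biclosed_def closed_roots_iff bitrans_on_def by (smt (verit, best) Diff_subset)
qed


text \<open>Formulated with \<open>select_op\<close>, so that no presentation of \<open>C\<close>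
  enters; the transfer to \<open>FC\<close> only needs the two maps to agree on biclosed
  sets.\<close>

lemma select_op_bij:
  "bij_betw (\<lambda>C. select_op (pts n) (rel C)) {C. biclosed n \<alpha> C} {F. quasitrivial_semigroup (pts n) F}"
  unfolding bij_betw_def
proof
  show "inj_on (\<lambda>C. select_op (pts n) (rel C)) {C. biclosed n \<alpha> C}"
  proof (rule inj_onI)
    fix C C'
    assume "C \<in> {C. biclosed n \<alpha> C}" "C' \<in> {C. biclosed n \<alpha> C}"
      and "select_op (pts n) (rel C) = select_op (pts n) (rel C')"
    then show "C = C'"
      unfolding mem_Collect_eq biclosed_iff select_op_eq_iff by (intro roots_subset_eqI) blast+
  qed
  have "F \<in> (\<lambda>C. select_op (pts n) (rel C)) ` {C. biclosed n \<alpha> C}"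
    if F: "quasitrivial_semigroup (pts n) F" for F
  proof -
    define C where "C = {root_ab \<alpha> x y | x y. x \<in> pts n \<and> y \<in> pts n \<and> x \<noteq> y \<and> F (x, y) = y}"
    have "rel C x y = (F (x, y) = y)" if "x \<in> pts n" "y \<in> pts n" "x \<noteq> y" for x y
      using that root_ab_inj[of x y] unfolding C_def by blast
    then have "select_op (pts n) (rel C) = select_op (pts n) (\<lambda>x y. F (x, y) = y)"
      by (simp add: select_op_eq_iff)
    from trans[OF quasitrivial_semigroup_eq_select_op[OF F] this[symmetric]]
    have eq: "F = select_op (pts n) (rel C)" .
    have "C \<subseteq> roots n \<alpha>" unfolding C_def roots_eq by blast
    moreover have "bitrans_on (pts n) (rel C)"
      using F[unfolded eq quasitrivial_semigroup_select_op] .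
    ultimately have "C \<in> {C. biclosed n \<alpha> C}" by (simp add: biclosed_iff)
    with eq show ?thesis by (rule image_eqI)
  qed
  then show "(\<lambda>C. select_op (pts n) (rel C)) ` {C. biclosed n \<alpha> C} = {F. quasitrivial_semigroup (pts n) F}"
    by (auto simp only: quasitrivial_semigroup_select_op biclosed_iff mem_Collect_eq)
qed

section \<open>Orthogonality, the action of permutations, and the sets \<open>Phi2\<close>\<close>

lemma bform_simple:
  assumes "i \<in> {1..n}" "j \<in> {1..n}"
  shows "bform n \<alpha> (\<alpha> i) (\<alpha> j) = (if i = j then 1 else if i = j + 1 \<or> j = i + 1 then - (1 / 2) else 0)"
proof -
  define c :: "nat \<Rightarrow> nat \<Rightarrow> real"
    where "c k l = (if k = l then 1 else if k = l + 1 \<or> l = k + 1 then - (1 / 2) else 0)" for k l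
  have "bform n \<alpha> (\<alpha> i) (\<alpha> j) = (\<Sum>k=1..n. \<Sum>l=1..n. crd k (\<alpha> i) * crd l (\<alpha> j) * c k l)"
    unfolding bform_def c_def by (intro sum.cong refl) (simp add: crd_def)
  also have "\<dots> = (\<Sum>k=1..n. \<Sum>l=1..n. if l = j then (if k = i then c k l else 0) else 0)"
    using assms by (intro sum.cong refl) (simp add: crd_simple)
  also have "\<dots> = c i j" using assms by simp
  finally show ?thesis by (simp add: c_def)
qed

text \<open>The form takes the non-zero values 1 on equal simple roots and -1/2 on neighbours in the
  Dynkin diagram.\<close>

lemma orthogonal_simpleD:
  assumes "orthogonal_simple n \<alpha> D1 D2" "l \<in> {1..n}"
  shows "\<not> (\<alpha> l \<in> D1 \<and> \<alpha> l \<in> D2)"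
    and "l + 1 \<in> {1..n} \<Longrightarrow> \<not> (\<alpha> l \<in> D1 \<and> \<alpha> (l + 1) \<in> D2) \<and> \<not> (\<alpha> l \<in> D2 \<and> \<alpha> (l + 1) \<in> D1)"
proof -
  have *: "bform n \<alpha> \<beta> \<gamma> = 0" if "\<beta> \<in> D1" "\<gamma> \<in> D2" for \<beta> \<gamma>
    using assms(1) that unfolding orthogonal_simple_def by blast
  show "\<not> (\<alpha> l \<in> D1 \<and> \<alpha> l \<in> D2)"
    using *[of "\<alpha> l" "\<alpha> l"] bform_simple[OF assms(2,2)] by auto
  show "\<not> (\<alpha> l \<in> D1 \<and> \<alpha> (l + 1) \<in> D2) \<and> \<not> (\<alpha> l \<in> D2 \<and> \<alpha> (l + 1) \<in> D1)" if "l + 1 \<in> {1..n}"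
    using *[of "\<alpha> l" "\<alpha> (l + 1)"] *[of "\<alpha> (l + 1)" "\<alpha> l"]
      bform_simple[OF assms(2) that] bform_simple[OF that assms(2)] by auto
qed

text \<open>\<open>act\<close> asks only for some pair of indices; injectivity of
  \<open>root_ab\<close> and of \<open>w\<close> makes this pair unique.\<close>

lemma act_rel:
  assumes "w permutes pts n" "a \<in> pts n" "b \<in> pts n" "a \<noteq> b"
  shows "rel (act n \<alpha> w C) (w a) (w b) = rel C a b"
proof
  assume "rel (act n \<alpha> w C) (w a) (w b)"
  then obtain c d where cd: "root_ab \<alpha> (w c) (w d) = root_ab \<alpha> (w a) (w b)"
      "c \<in> pts n" "d \<in> pts n" "c \<noteq> d" "rel C c d"
    unfolding act_def by auto
  have w: "w x \<in> pts n" if "x \<in> pts n" for x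
    using that permutes_in_image[OF assms(1)] by blast
  have "w c \<noteq> w d" using cd(4) permutes_inj[OF assms(1)] by (metis injD)
  then have "w c = w a \<and> w d = w b"
    using root_ab_inj[OF w w w w _ cd(1)] cd assms by blast
  then have "c = a" "d = b" using permutes_inj[OF assms(1)] by (metis injD)+
  then show "rel C a b" using cd(5) by simp
qed (use assms in \<open>unfold act_def, blast\<close>)

lemma act_subset_roots:
  assumes "w permutes pts n"
  shows "act n \<alpha> w C \<subseteq> roots n \<alpha>"
proof
  fix v assume "v \<in> act n \<alpha> w C"
  then obtain a b where ab: "v = root_ab \<alpha> (w a) (w b)" "a \<in> pts n" "b \<in> pts n" "a \<noteq> b"
    unfolding act_def by blast
  have "w a \<in> pts n" "w b \<in> pts n" using ab permutes_in_image[OF assms] by blast+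
  moreover have "w a \<noteq> w b" using ab(4) permutes_inj[OF assms] by (metis injD)
  ultimately show "v \<in> roots n \<alpha>" unfolding ab(1) using root_ab_in_roots by blast
qed

text \<open>The coordinate of this root along each \<open>\<alpha> l\<close> with \<open>l\<close>
  in \<open>{a..<b}\<close> is 1, while a vector in \<open>span D\<close> has non-zero coordinates
  only along \<open>D\<close>.\<close>

lemma root_ab_in_span:
  assumes "D \<subseteq> simple_roots n \<alpha>" "a \<in> pts n" "b \<in> pts n" "a < b"
  shows "root_ab \<alpha> a b \<in> span D \<longleftrightarrow> (\<forall>l\<in>{a..<b}. \<alpha> l \<in> D)"
proof
  assume v: "root_ab \<alpha> a b \<in> span D"
  show "\<forall>l\<in>{a..<b}. \<alpha> l \<in> D"
  proof
    fix l assume l: "l \<in> {a..<b}"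
    then have "crd l (root_ab \<alpha> a b) = 1" using assms by (subst crd_root_ab) auto
    moreover have "crd l (root_ab \<alpha> a b) = representation D (root_ab \<alpha> a b) (\<alpha> l)"
      using l assms representation_extend[OF indep' v assms(1)] by (simp add: crd_def)
    ultimately show "\<alpha> l \<in> D" using representation_ne_zero by (metis zero_neq_one)
  qed
next
  assume D: "\<forall>l\<in>{a..<b}. \<alpha> l \<in> D"
  have "sum \<alpha> {a..<b} \<in> span D" by (intro span_sum span_base) (use D in blast)
  then show "root_ab \<alpha> a b \<in> span D" using assms(4) by (simp add: root_ab_def)
qed

text \<open>Among positive roots the part from \<open>span D2\<close> adds nothing, since by
  orthogonality such a root lies outside \<open>span D1\<close>; among negative roots it is the only
  contribution.\<close>

lemma Phi2_rel:
  assumes o: "orthogonal_simple n \<alpha> D1 D2" and ab: "a \<in> pts n" "b \<in> pts n" "a < b"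
  shows "rel (Phi2 n \<alpha> D1 D2) a b \<longleftrightarrow> \<not> (\<forall>l\<in>{a..<b}. \<alpha> l \<in> D1)"
    and "rel (Phi2 n \<alpha> D1 D2) b a \<longleftrightarrow> (\<forall>l\<in>{a..<b}. \<alpha> l \<in> D2)"
proof -
  have D: "D1 \<subseteq> simple_roots n \<alpha>" "D2 \<subseteq> simple_roots n \<alpha>"
    using o by (auto simp: orthogonal_simple_def)
  have "\<not> (\<alpha> a \<in> D1 \<and> \<alpha> a \<in> D2)" using orthogonal_simpleD(1)[OF o, of a] ab by auto
  then have disj: "\<not> (\<forall>l\<in>{a..<b}. \<alpha> l \<in> D1)" if "\<forall>l\<in>{a..<b}. \<alpha> l \<in> D2"
    using that ab by auto
  have "rel (pos_roots n \<alpha>) a b" "\<not> rel (pos_roots n \<alpha>) b a"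
    "rel (roots n \<alpha>) a b" "rel (roots n \<alpha>) b a"
    using ab root_ab_in_pos_roots[of a b] root_ab_in_pos_roots[of b a]
      root_ab_in_roots[of a b] root_ab_in_roots[of b a] by auto
  moreover have "root_ab \<alpha> b a \<in> span D2 \<longleftrightarrow> root_ab \<alpha> a b \<in> span D2"
    using span_neg root_ab_swap by metis
  ultimately show "rel (Phi2 n \<alpha> D1 D2) a b \<longleftrightarrow> \<not> (\<forall>l\<in>{a..<b}. \<alpha> l \<in> D1)"
    and "rel (Phi2 n \<alpha> D1 D2) b a \<longleftrightarrow> (\<forall>l\<in>{a..<b}. \<alpha> l \<in> D2)"
    using root_ab_in_span[OF D(1) ab] root_ab_in_span[OF D(2) ab] disj
    unfolding Phi2_def by blast+
qed

section \<open>Presentations of biclosed sets\<close>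

definition presents :: "(nat \<Rightarrow> nat) \<Rightarrow> 'v set \<Rightarrow> 'v set \<Rightarrow> 'v set \<Rightarrow> bool" where
  "presents \<sigma> D1 D2 C \<longleftrightarrow> \<sigma> permutes pts n \<and> orthogonal_simple n \<alpha> D1 D2 \<and>
     C = act n \<alpha> \<sigma> (Phi2 n \<alpha> D1 D2)"

lemma presents_rel:
  assumes "presents \<sigma> D1 D2 C" "a \<in> pts n" "b \<in> pts n" "a < b"
  shows "rel C (\<sigma> a) (\<sigma> b) \<longleftrightarrow> \<not> (\<forall>l\<in>{a..<b}. \<alpha> l \<in> D1)"
    and "rel C (\<sigma> b) (\<sigma> a) \<longleftrightarrow> (\<forall>l\<in>{a..<b}. \<alpha> l \<in> D2)"
proof -
  have p: "\<sigma> permutes pts n" "orthogonal_simple n \<alpha> D1 D2" "C = act n \<alpha> \<sigma> (Phi2 n \<alpha> D1 D2)"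
    using assms(1) unfolding presents_def by blast+
  have ne: "a \<noteq> b" "b \<noteq> a" using assms(4) by auto
  show "rel C (\<sigma> a) (\<sigma> b) \<longleftrightarrow> \<not> (\<forall>l\<in>{a..<b}. \<alpha> l \<in> D1)"
    unfolding p(3) act_rel[OF p(1) assms(2,3) ne(1)] by (rule Phi2_rel(1)[OF p(2) assms(2-4)])
  show "rel C (\<sigma> b) (\<sigma> a) \<longleftrightarrow> (\<forall>l\<in>{a..<b}. \<alpha> l \<in> D2)"
    unfolding p(3) act_rel[OF p(1) assms(3,2) ne(2)] by (rule Phi2_rel(2)[OF p(2) assms(2-4)])
qed

text \<open>The converse of the construction by sorting: every presentation lists the points in
  sorted order. This pins down the first and last point in the results on identities and
  zeros.\<close>

lemma presents_sorted:
  assumes "presents \<sigma> D1 D2 C" "a \<in> pts n" "b \<in> pts n" "a < b" "rel C (\<sigma> b) (\<sigma> a)"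
  shows "rel C (\<sigma> a) (\<sigma> b)"
proof -
  have "\<alpha> a \<in> D2" using presents_rel(2)[OF assms(1-4)] assms(4,5) by auto
  moreover have "\<not> (\<alpha> a \<in> D1 \<and> \<alpha> a \<in> D2)"
    using assms orthogonal_simpleD(1)[of D1 D2 a] unfolding presents_def by auto
  ultimately show ?thesis using presents_rel(1)[OF assms(1-4)] assms(4) by auto
qed

lemma permutes_ptsE:
  assumes "\<sigma> permutes pts n" "x \<in> pts n"
  obtains a where "a \<in> pts n" "x = \<sigma> a" "inv \<sigma> x = a"
  using assms permutes_inverses[OF assms(1)] permutes_in_image[OF permutes_inv[OF assms(1)]] by metis

lemma permutes_pts_image: "\<sigma> permutes pts n \<Longrightarrow> x \<in> pts n \<Longrightarrow> \<exists>a\<in>pts n. x = \<sigma> a"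
  using permutes_image by blast

lemma presents_exists:
  assumes "biclosed n \<alpha> C"
  shows "\<exists>\<sigma> D1 D2. presents \<sigma> D1 D2 C"
proof -
  have C: "C \<subseteq> roots n \<alpha>" and b: "bitrans_on (pts n) (rel C)"
    using assms unfolding biclosed_iff by blast+
  obtain \<sigma> where \<sigma>: "\<sigma> permutes pts n"
    and sort0: "\<And>a b. a \<in> pts n \<Longrightarrow> b \<in> pts n \<Longrightarrow> a < b \<Longrightarrow> rel C (\<sigma> b) (\<sigma> a) \<Longrightarrow> rel C (\<sigma> a) (\<sigma> b)"
    using bitrans_on_sorting[OF b] by metis
  define S where "S a b = rel C (\<sigma> a) (\<sigma> b)" for a b
  have sort: "S a b" if "a \<in> pts n" "b \<in> pts n" "a < b" "S b a" for a b
    using that sort0 unfolding S_def by blast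
  have bS: "bitrans_on (pts n) S"
    unfolding S_def using b bitrans_on_reindex[OF \<sigma>, of "rel C"] by blast
  \<comment> \<open>\<open>presents_rel\<close> on consecutive points forces these choices. As
    \<open>S\<close> is sorted, \<open>D1\<close> collects the steps related in neither direction
    and \<open>D2\<close> those related in both.\<close>
  define D1 where "D1 = \<alpha> ` {l \<in> {1..n}. \<not> S l (l + 1)}"
  define D2 where "D2 = \<alpha> ` {l \<in> {1..n}. S (l + 1) l}"
  have D1: "\<alpha> l \<in> D1 \<longleftrightarrow> \<not> S l (l + 1)" and D2: "\<alpha> l \<in> D2 \<longleftrightarrow> S (l + 1) l" if "l \<in> {1..n}" for l
    using that inj_onD[OF inj] unfolding D1_def D2_def by blast+
  have orth: "orthogonal_simple n \<alpha> D1 D2"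
    unfolding orthogonal_simple_def
  proof (intro conjI ballI)
    show "D1 \<subseteq> simple_roots n \<alpha>" "D2 \<subseteq> simple_roots n \<alpha>"
      by (auto simp: D1_def D2_def simple_roots_def)
    fix \<beta> \<gamma> assume "\<beta> \<in> D1" "\<gamma> \<in> D2"
    then obtain l m where l: "\<beta> = \<alpha> l" "l \<in> {1..n}" "\<not> S l (l + 1)"
      and m: "\<gamma> = \<alpha> m" "m \<in> {1..n}" "S (m + 1) m"
      unfolding D1_def D2_def by blast
    have l': "\<not> S (l + 1) l" using sort[of l "l + 1"] l by auto
    have m': "S m (m + 1)" using sort[of m "m + 1"] m by auto
    have "l \<noteq> m" using l' m by auto
    \<comment> \<open>Steps of different kinds cannot be adjacent: whichever truth value
      \<open>S l (l + 2)\<close> has, one half of bitransitivity transports it to a contradiction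
      with one of the two steps.\<close>
    moreover have "m \<noteq> l + 1"
    proof
      assume ml: "m = l + 1"
      have pts: "l \<in> pts n" "l + 1 \<in> pts n" "l + 2 \<in> pts n" using l m ml by auto
      show False
      proof (cases "S l (l + 2)")
        case True
        then show ?thesis using bitrans_onD(1)[OF bS pts(1,3,2)] l(3) m(3) ml by auto
      next
        case False
        then show ?thesis using bitrans_onD(2)[OF bS pts(2,1,3)] l' m' ml by auto
      qed
    qed
    moreover have "l \<noteq> m + 1"
    proof
      assume lm: "l = m + 1"
      have pts: "m \<in> pts n" "m + 1 \<in> pts n" "m + 2 \<in> pts n" using l m lm by auto
      show False
      proof (cases "S m (m + 2)")
        case True
        then show ?thesis using bitrans_onD(1)[OF bS pts(2,1,3)] l(3) m(3) lm by auto
      next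
        case False
        then show ?thesis using bitrans_onD(2)[OF bS pts(1,3,2)] l' m' lm by auto
      qed
    qed
    ultimately show "bform n \<alpha> \<beta> \<gamma> = 0" using bform_simple[of l m] l m by simp
  qed
  have "C = act n \<alpha> \<sigma> (Phi2 n \<alpha> D1 D2)" (is "C = ?C'")
  proof (rule roots_subset_eqI[OF C act_subset_roots[OF \<sigma>]])
    have p: "presents \<sigma> D1 D2 ?C'" using \<sigma> orth by (simp add: presents_def)
    have main: "rel C (\<sigma> a) (\<sigma> b) = rel ?C' (\<sigma> a) (\<sigma> b)" "rel C (\<sigma> b) (\<sigma> a) = rel ?C' (\<sigma> b) (\<sigma> a)"
      if ab: "a \<in> pts n" "b \<in> pts n" "a < b" for a b
    proof -
      have ln: "l \<in> {1..n}" if "l \<in> {a..<b}" for l using that ab by auto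
      have "\<not> S a b \<longleftrightarrow> (\<forall>l\<in>{a..<b}. \<not> S l (l + 1))"
        by (rule sorted_bitrans_gap[OF bS _ ab]) (use sort in blast)
      then show "rel C (\<sigma> a) (\<sigma> b) = rel ?C' (\<sigma> a) (\<sigma> b)"
        using presents_rel(1)[OF p ab] D1 ln
        unfolding S_def by metis
      \<comment> \<open>The converse complement of \<open>S\<close> is sorted as well, its sorting
        condition being the contrapositive of the one for \<open>S\<close>.\<close>
      have "\<not> \<not> S b a \<longleftrightarrow> (\<forall>l\<in>{a..<b}. \<not> \<not> S (l + 1) l)"
        by (rule sorted_bitrans_gap[OF bitrans_on_dual[OF bS] _ ab]) (use sort in blast)
      then show "rel C (\<sigma> b) (\<sigma> a) = rel ?C' (\<sigma> b) (\<sigma> a)"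
        using presents_rel(2)[OF p ab] D2 ln unfolding S_def by metis
    qed
    fix x y assume xy: "x \<in> pts n" "y \<in> pts n" "x \<noteq> y"
    obtain a b where "a \<in> pts n" "x = \<sigma> a" "b \<in> pts n" "y = \<sigma> b"
      using permutes_pts_image[OF \<sigma> xy(1)] permutes_pts_image[OF \<sigma> xy(2)] by blast
    then show "rel C x y = rel ?C' x y"
      using main[of a b] main[of b a] xy(3) by (cases a b rule: linorder_cases) blast+
  qed
  then show ?thesis using \<sigma> orth unfolding presents_def by blast
qed

section \<open>Intervals, and \<open>FC\<close> as a well-defined map\<close>

lemma interval_of_eq_iff:
  assumes "a \<in> pts n" "b \<in> pts n"
  shows "interval_of n \<alpha> D a = interval_of n \<alpha> D b \<longleftrightarrow> (\<forall>l\<in>{min a b..<max a b}. \<alpha> l \<in> D)"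
proof
  assume "interval_of n \<alpha> D a = interval_of n \<alpha> D b"
  moreover have "b \<in> interval_of n \<alpha> D b" using assms by (simp add: interval_of_def)
  ultimately have "b \<in> interval_of n \<alpha> D a" by simp
  then show "\<forall>l\<in>{min a b..<max a b}. \<alpha> l \<in> D" by (simp add: interval_of_def)
next
  assume h: "\<forall>l\<in>{min a b..<max a b}. \<alpha> l \<in> D"
  have "(\<forall>l\<in>{min a c..<max a c}. \<alpha> l \<in> D) \<longleftrightarrow> (\<forall>l\<in>{min b c..<max b c}. \<alpha> l \<in> D)" for c
  proof -
    have "{min a c..<max a c} \<subseteq> {min b c..<max b c} \<union> {min a b..<max a b}"
      "{min b c..<max b c} \<subseteq> {min a c..<max a c} \<union> {min a b..<max a b}"
      by auto
    with h show ?thesis by blast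
  qed
  then show "interval_of n \<alpha> D a = interval_of n \<alpha> D b"
    unfolding interval_of_def by blast
qed

text \<open>If \<open>interval_from\<close> fails, some step of the interval lies outside
  \<open>D1\<close>, hence in \<open>D2\<close>; orthogonality spreads this label over the whole
  stretch.\<close>

lemma interval_all_in_D2:
  assumes o: "orthogonal_simple n \<alpha> D1 D2" and a: "a \<in> pts n" "b \<in> pts n"
    and ab: "b \<in> interval_of n \<alpha> (D1 \<union> D2) a"
    and no: "\<not> interval_from \<alpha> D1 (interval_of n \<alpha> (D1 \<union> D2) a)"
    and l: "l \<in> {min a b..<max a b}"
  shows "\<alpha> l \<in> D2"
proof -
  obtain k where k: "k \<in> interval_of n \<alpha> (D1 \<union> D2) a" "k + 1 \<in> interval_of n \<alpha> (D1 \<union> D2) a"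
    "\<alpha> k \<notin> D1"
    using no unfolding interval_from_def by blast
  \<comment> \<open>The points from \<open>p\<close> to \<open>q\<close> are the hull of
    \<open>a\<close>, \<open>b\<close> and the witness step from \<open>k\<close> to
    \<open>k + 1\<close>.\<close>
  define p where "p = min (min a b) k"
  define q where "q = max (max a b) (k + 1)"
  have bounds: "1 \<le> p" "q \<le> n + 1" using a k by (auto simp: p_def q_def interval_of_def)
  have link: "\<alpha> i \<in> D1 \<union> D2" if "i \<in> {p..<q}" for i
  proof -
    have "i \<in> {min a b..<max a b} \<union> {min a k..<max a k} \<union> {min a (k + 1)..<max a (k + 1)}"
      using that unfolding p_def q_def by auto
    then show ?thesis using ab k(1,2) unfolding interval_of_def by blast
  qed
  show ?thesis
  proof (rule linked_blocks_uniform[of p q "\<lambda>l. \<alpha> l \<in> D1" "\<lambda>l. \<alpha> l \<in> D2" k])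
    show "\<alpha> i \<in> D1 \<or> \<alpha> i \<in> D2" if "p \<le> i" "i < q" for i using link[of i] that by auto
    show "\<not> (\<alpha> i \<in> D1 \<and> \<alpha> i \<in> D2)" if "p \<le> i" "i < q" for i
      using orthogonal_simpleD(1)[OF o, of i] that bounds by auto
    show "\<not> (\<alpha> i \<in> D1 \<and> \<alpha> (i + 1) \<in> D2) \<and> \<not> (\<alpha> i \<in> D2 \<and> \<alpha> (i + 1) \<in> D1)"
      if "p \<le> i" "i + 1 < q" for i
      using orthogonal_simpleD(2)[OF o, of i] that bounds by auto
    show kb: "p \<le> k" "k < q" by (auto simp: p_def q_def)
    show "\<alpha> k \<in> D2" using link[of k] k(3) kb by auto
    show "p \<le> l" "l < q" using l by (auto simp: p_def q_def)
  qed
qed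

text \<open>The right-hand side mentions only \<open>C\<close>, so this also proves that the choice
  of presentation does not matter.\<close>

lemma semigroup_of_eq:
  assumes p: "presents \<sigma> D1 D2 C"
  shows "semigroup_of n \<alpha> \<sigma> D1 D2 = select_op (pts n) (rel C)"
proof -
  have \<sigma>: "\<sigma> permutes pts n" and o: "orthogonal_simple n \<alpha> D1 D2"
    using p unfolding presents_def by blast+
  let ?D = "D1 \<union> D2"
  let ?I = "interval_of n \<alpha> ?D"
  have "(if \<not> preorder_of n \<alpha> \<sigma> ?D y x then y
         else if \<not> preorder_of n \<alpha> \<sigma> ?D x y then x
         else if interval_from \<alpha> D1 (?I (inv \<sigma> x)) then x else y) = (if rel C x y then y else x)"
    if x: "x \<in> pts n" and y: "y \<in> pts n" and xy: "x \<noteq> y" for x y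
  proof -
    obtain a where a: "a \<in> pts n" "x = \<sigma> a" "inv \<sigma> x = a" using permutes_ptsE[OF \<sigma> x] .
    obtain b where b: "b \<in> pts n" "y = \<sigma> b" "inv \<sigma> y = b" using permutes_ptsE[OF \<sigma> y] .
    have ab: "a \<noteq> b" using a b xy by blast
    note eq = interval_of_eq_iff[OF a(1) b(1), of ?D]
    have lt: "rel C x y \<longleftrightarrow> \<not> (\<forall>l\<in>{a..<b}. \<alpha> l \<in> D1)" if "a < b"
      using presents_rel(1)[OF p a(1) b(1) that] a b by simp
    have gt: "rel C x y \<longleftrightarrow> (\<forall>l\<in>{b..<a}. \<alpha> l \<in> D2)" if "b < a"
      using presents_rel(2)[OF p b(1) a(1) that] a b by simp
    show ?thesis
    proof (cases "?I a = ?I b")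
      case False
      \<comment> \<open>Some step between the positions lies outside both \<open>D1\<close> and
        \<open>D2\<close>, so position alone decides.\<close>
      then have "rel C x y \<longleftrightarrow> a < b"
        using eq lt gt ab by (cases a b rule: linorder_cases) (auto simp: min_def max_def)
      then show ?thesis using False a(3) b(3) ab unfolding preorder_of_def by auto
    next
      case True
      have mem: "b \<in> ?I a" using True b(1) by (simp add: interval_of_def)
      have disj: "\<not> (\<alpha> l \<in> D1 \<and> \<alpha> l \<in> D2)" if "l \<in> {min a b..<max a b}" for l
        using orthogonal_simpleD(1)[OF o, of l] that a(1) b(1)
        by (auto simp: min_def max_def split: if_splits)
      have "rel C x y \<longleftrightarrow> \<not> interval_from \<alpha> D1 (?I a)"
      proof (cases "interval_from \<alpha> D1 (?I a)")
        case True
        \<comment> \<open>Both ends of a step between \<open>a\<close> and \<open>b\<close> belong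
          to the interval, which is what \<open>interval_from\<close> asks for.\<close>
        have "\<alpha> l \<in> D1" if l: "l \<in> {min a b..<max a b}" for l
        proof -
          have "{min a l..<max a l} \<subseteq> {min a b..<max a b}"
            "{min a (l + 1)..<max a (l + 1)} \<subseteq> {min a b..<max a b}"
            using l by auto
          moreover have "l \<in> pts n" "l + 1 \<in> pts n"
            using l a(1) b(1) by (auto simp: min_def max_def split: if_splits)
          moreover have "\<forall>l\<in>{min a b..<max a b}. \<alpha> l \<in> ?D"
            using mem unfolding interval_of_def by blast
          ultimately have "l \<in> ?I a" "l + 1 \<in> ?I a"
            unfolding interval_of_def by blast+
          then show ?thesis using True unfolding interval_from_def by blast
        qed
        then have "\<not> rel C x y"
          using lt gt ab disj by (cases a b rule: linorder_cases) fastforce+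
        then show ?thesis using True by simp
      next
        case no: False
        have "\<alpha> l \<in> D2" if l: "l \<in> {min a b..<max a b}" for l
          by (rule interval_all_in_D2[OF o a(1) b(1) mem no l])
        then have "rel C x y"
          using lt gt ab disj by (cases a b rule: linorder_cases) fastforce+
        then show ?thesis using no by simp
      qed
      then show ?thesis using True a(3) b(3) unfolding preorder_of_def by simp
    qed
  qed
  then have eq: "(if \<not> preorder_of n \<alpha> \<sigma> ?D y x then y
         else if \<not> preorder_of n \<alpha> \<sigma> ?D x y then x
         else if interval_from \<alpha> D1 (?I (inv \<sigma> x)) then x else y) = (if rel C x y then y else x)"
    if "x \<in> pts n" "y \<in> pts n" for x y
    using that by (cases "x = y") simp_all
  show ?thesis
    unfolding semigroup_of_def select_op_def
    by (rule restrict_ext) (use eq in \<open>simp only: split_paired_all mem_Sigma_iff prod.case\<close>)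
qed

lemma FC_eq:
  assumes "presents \<sigma> D1 D2 C"
  shows "FC n \<alpha> C = select_op (pts n) (rel C)"
  unfolding FC_def
proof (rule the_equality)
  show "\<exists>\<sigma> D1 D2. \<sigma> permutes pts n \<and> orthogonal_simple n \<alpha> D1 D2 \<and>
     C = act n \<alpha> \<sigma> (Phi2 n \<alpha> D1 D2) \<and> select_op (pts n) (rel C) = semigroup_of n \<alpha> \<sigma> D1 D2"
    using assms semigroup_of_eq[OF assms] unfolding presents_def by metis
  fix F
  assume "\<exists>\<sigma> D1 D2. \<sigma> permutes pts n \<and> orthogonal_simple n \<alpha> D1 D2 \<and>
     C = act n \<alpha> \<sigma> (Phi2 n \<alpha> D1 D2) \<and> F = semigroup_of n \<alpha> \<sigma> D1 D2"
  then obtain \<sigma> D1 D2 where "presents \<sigma> D1 D2 C" "F = semigroup_of n \<alpha> \<sigma> D1 D2"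
    unfolding presents_def by blast
  then show "F = select_op (pts n) (rel C)" using semigroup_of_eq by metis
qed

lemma FC_biclosed:
  assumes "biclosed n \<alpha> C"
  shows "FC n \<alpha> C = select_op (pts n) (rel C)"
proof -
  obtain \<sigma> D1 D2 where "presents \<sigma> D1 D2 C" using presents_exists[OF assms] by blast
  then show ?thesis by (rule FC_eq)
qed

lemma FC_bij: "bij_betw (FC n \<alpha>) {C. biclosed n \<alpha> C} {F. quasitrivial_semigroup (pts n) F}"
  by (rule bij_betw_cong[THEN iffD2, OF _ select_op_bij]) (simp only: mem_Collect_eq FC_biclosed)

text \<open>The bijections for special classes are restrictions of a single one; what remains is to
  match a condition on \<open>C\<close> with one on the selection operation.\<close>

lemma FC_bij_sub:
  assumes "\<And>C. Q C \<Longrightarrow> biclosed n \<alpha> C"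
    and "\<And>C. biclosed n \<alpha> C \<Longrightarrow> Q C \<longleftrightarrow> P (select_op (pts n) (rel C))"
  shows "bij_betw (FC n \<alpha>) {C. Q C} {F. quasitrivial_semigroup (pts n) F \<and> P F}"
proof -
  have "bij_betw (FC n \<alpha>) {C. Q C} {F. F \<in> {F. quasitrivial_semigroup (pts n) F} \<and> P F}"
  proof (rule bij_betw_sub[OF FC_bij])
    show "{C. Q C} \<subseteq> {C. biclosed n \<alpha> C}" using assms(1) by blast
    show "C \<in> {C. Q C} \<longleftrightarrow> P (FC n \<alpha> C)" if "C \<in> {C. biclosed n \<alpha> C}" for C
      using that assms(2)[of C] FC_biclosed[of C] by simp
  qed
  then show ?thesis by (simp only: mem_Collect_eq)
qed

section \<open>Special classes of biclosed sets\<close>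

lemma biclosed_trivial: "biclosed n \<alpha> {}" "biclosed n \<alpha> (roots n \<alpha>)"
proof -
  show "biclosed n \<alpha> {}" by (simp add: biclosed_iff bitrans_on_def)
  have "bitrans_on (pts n) (rel (roots n \<alpha>)) = bitrans_on (pts n) (\<lambda>x y. True)"
    by (rule bitrans_on_cong) (simp add: root_ab_in_roots)
  moreover have "bitrans_on (pts n) (\<lambda>x y. True)" by (simp add: bitrans_on_def)
  ultimately show "biclosed n \<alpha> (roots n \<alpha>)" unfolding biclosed_iff by simp
qed

lemma zero_notin_roots: "0 \<notin> roots n \<alpha>"
  using root_ab_in_roots[of 1 1] by (simp add: root_ab_def)

lemma Phi2_simple_empty: "Phi2 n \<alpha> (simple_roots n \<alpha>) {} = {}"
  using zero_notin_roots by (auto simp: Phi2_def span_eq')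

lemma Phi2_empty_simple: "Phi2 n \<alpha> {} (simple_roots n \<alpha>) = roots n \<alpha>"
  using zero_notin_roots by (auto simp: Phi2_def span_eq' roots_def)

text \<open>For \<open>a < b\<close> the range is empty and the condition holds, so one formula
  serves both orders of \<open>a\<close> and \<open>b\<close>. In the horocyclic case the empty
  range occurs for \<open>b < a\<close> and gives a negative answer.\<close>

lemma presents_parabolic:
  assumes "presents \<sigma> {} D2 C" "a \<in> pts n" "b \<in> pts n" "a \<noteq> b"
  shows "rel C (\<sigma> a) (\<sigma> b) \<longleftrightarrow> (\<forall>l\<in>{b..<a}. \<alpha> l \<in> D2)"
  using presents_rel(1)[OF assms(1,2,3)] presents_rel(2)[OF assms(1,3,2)] assms(4)
  by (cases a b rule: linorder_cases) auto

lemma presents_horocyclic: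
  assumes "presents \<sigma> D1 {} C" "a \<in> pts n" "b \<in> pts n" "a \<noteq> b"
  shows "rel C (\<sigma> a) (\<sigma> b) \<longleftrightarrow> \<not> (\<forall>l\<in>{a..<b}. \<alpha> l \<in> D1)"
  using presents_rel(1)[OF assms(1,2,3)] presents_rel(2)[OF assms(1,3,2)] assms(4)
  by (cases a b rule: linorder_cases) auto

section \<open>Parabolic and horocyclic sets\<close>

lemma parabolic_iff_presents: "parabolic n \<alpha> C \<longleftrightarrow> (\<exists>\<sigma> D2. presents \<sigma> {} D2 C)"
  unfolding parabolic_def presents_def orthogonal_simple_def by blast

lemma horocyclic_iff_presents: "horocyclic n \<alpha> C \<longleftrightarrow> (\<exists>\<sigma> D1. presents \<sigma> D1 {} C)"
  unfolding horocyclic_def presents_def orthogonal_simple_def by blast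

text \<open>Parabolic and horocyclic sets are defined by presentations only; their biclosedness is
  checked on positions and carried over by \<open>\<sigma>\<close>.\<close>

lemma presents_biclosed:
  assumes p: "presents \<sigma> D1 D2 C" and "bitrans_on (pts n) S"
    and "\<And>a b. a \<in> pts n \<Longrightarrow> b \<in> pts n \<Longrightarrow> a \<noteq> b \<Longrightarrow> rel C (\<sigma> a) (\<sigma> b) = S a b"
  shows "biclosed n \<alpha> C"
proof -
  have \<sigma>: "\<sigma> permutes pts n" and C: "C = act n \<alpha> \<sigma> (Phi2 n \<alpha> D1 D2)"
    using p unfolding presents_def by blast+
  have "bitrans_on (pts n) (\<lambda>a b. rel C (\<sigma> a) (\<sigma> b)) = bitrans_on (pts n) S"
    by (rule bitrans_on_cong) (rule assms(3))
  then have "bitrans_on (pts n) (rel C)"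
    using assms(2) bitrans_on_reindex[OF \<sigma>, of "rel C"] by blast
  then show ?thesis
    using act_subset_roots[OF \<sigma>] C unfolding biclosed_iff by blast
qed

lemma bitrans_on_all_below: "bitrans_on (pts n) (\<lambda>a b. \<forall>l\<in>{b..<a}. P l)"
proof -
  have closed: "\<forall>l\<in>{c..<a}. P l" if "\<forall>l\<in>{b..<a}. P l" "\<forall>l\<in>{c..<b}. P l" for a b c :: nat
  proof -
    have "{c..<a} \<subseteq> {b..<a} \<union> {c..<b}" by auto
    with that show ?thesis by blast
  qed
  have coclosed: "\<not> (\<forall>l\<in>{c..<a}. P l)" if h: "\<not> (\<forall>l\<in>{b..<a}. P l)" "\<not> (\<forall>l\<in>{c..<b}. P l)"
    for a b c :: nat
  proof -
    \<comment> \<open>The second failure serves only to give \<open>c < b\<close>, which places the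
      first counterexample in \<open>{c..<a}\<close>.\<close>
    obtain l m where l: "l \<in> {b..<a}" "\<not> P l" and m: "m \<in> {c..<b}" using h by blast
    then have "l \<in> {c..<a}" by auto
    with l(2) show ?thesis by blast
  qed
  show ?thesis
    unfolding bitrans_on_def
  proof (rule ballI, rule ballI, rule ballI, rule impI, rule conjI)
    fix a b c
    show "(\<forall>l\<in>{b..<a}. P l) \<longrightarrow> (\<forall>l\<in>{c..<b}. P l) \<longrightarrow> (\<forall>l\<in>{c..<a}. P l)"
      by (rule impI, rule impI, rule closed)
    show "\<not> (\<forall>l\<in>{b..<a}. P l) \<longrightarrow> \<not> (\<forall>l\<in>{c..<b}. P l) \<longrightarrow> \<not> (\<forall>l\<in>{c..<a}. P l)"
      by (rule impI, rule impI, rule coclosed)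
  qed
qed

text \<open>A simple root in \<open>D1\<close> would leave two consecutive points unrelated in both
  directions. Conversely, if \<open>D1\<close> is empty, one of the two ranges between any two
  positions is empty and yields a relation.\<close>

lemma parabolic_iff:
  "parabolic n \<alpha> C \<longleftrightarrow> biclosed n \<alpha> C \<and>
     (\<forall>x\<in>pts n. \<forall>y\<in>pts n. x \<noteq> y \<longrightarrow> rel C x y \<or> rel C y x)"
proof
  assume "parabolic n \<alpha> C"
  then obtain \<sigma> D2 where p: "presents \<sigma> {} D2 C" unfolding parabolic_iff_presents by blast
  then have \<sigma>: "\<sigma> permutes pts n" unfolding presents_def by blast
  have "rel C x y \<or> rel C y x" if xy: "x \<in> pts n" "y \<in> pts n" "x \<noteq> y" for x y
  proof -
    obtain a b where ab: "a \<in> pts n" "x = \<sigma> a" "b \<in> pts n" "y = \<sigma> b"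
      using permutes_pts_image[OF \<sigma> xy(1)] permutes_pts_image[OF \<sigma> xy(2)] by blast
    then have ne: "a \<noteq> b" using xy(3) by blast
    have "(\<forall>l\<in>{b..<a}. \<alpha> l \<in> D2) \<or> (\<forall>l\<in>{a..<b}. \<alpha> l \<in> D2)"
      by (cases "a \<le> b") simp_all
    then show ?thesis
      unfolding ab(2,4) presents_parabolic[OF p ab(1,3) ne] presents_parabolic[OF p ab(3,1) ne[symmetric]]
      by blast
  qed
  then show "biclosed n \<alpha> C \<and> (\<forall>x\<in>pts n. \<forall>y\<in>pts n. x \<noteq> y \<longrightarrow> rel C x y \<or> rel C y x)"
    using presents_biclosed[OF p bitrans_on_all_below presents_parabolic[OF p]] by blast
next
  assume h: "biclosed n \<alpha> C \<and> (\<forall>x\<in>pts n. \<forall>y\<in>pts n. x \<noteq> y \<longrightarrow> rel C x y \<or> rel C y x)"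
  then obtain \<sigma> D1 D2 where p: "presents \<sigma> D1 D2 C" using presents_exists by blast
  then have \<sigma>: "\<sigma> permutes pts n" and D1: "D1 \<subseteq> simple_roots n \<alpha>"
    unfolding presents_def orthogonal_simple_def by blast+
  have "\<alpha> l \<notin> D1" if l: "l \<in> {1..n}" for l
  proof
    assume "\<alpha> l \<in> D1"
    have pts: "l \<in> pts n" "l + 1 \<in> pts n" "l < l + 1" using l by auto
    have "\<sigma> l \<in> pts n" "\<sigma> (l + 1) \<in> pts n" using pts permutes_in_image[OF \<sigma>] by blast+
    moreover have "\<sigma> l \<noteq> \<sigma> (l + 1)" using permutes_inj[OF \<sigma>] by (simp add: inj_eq)
    ultimately have "rel C (\<sigma> l) (\<sigma> (l + 1))"
      using h presents_sorted[OF p pts] by blast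
    then show False using presents_rel(1)[OF p pts] \<open>\<alpha> l \<in> D1\<close> by simp
  qed
  then have "D1 = {}" using D1 unfolding simple_roots_def by blast
  then show "parabolic n \<alpha> C" using p parabolic_iff_presents by blast
qed

text \<open>Dually, a simple root in \<open>D2\<close> would relate two consecutive points in both
  directions.\<close>

lemma horocyclic_iff:
  "horocyclic n \<alpha> C \<longleftrightarrow> biclosed n \<alpha> C \<and>
     (\<forall>x\<in>pts n. \<forall>y\<in>pts n. x \<noteq> y \<longrightarrow> \<not> (rel C x y \<and> rel C y x))"
proof
  assume "horocyclic n \<alpha> C"
  then obtain \<sigma> D1 where p: "presents \<sigma> D1 {} C" unfolding horocyclic_iff_presents by blast
  then have \<sigma>: "\<sigma> permutes pts n" unfolding presents_def by blast
  have "\<not> (rel C x y \<and> rel C y x)" if xy: "x \<in> pts n" "y \<in> pts n" "x \<noteq> y" for x y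
  proof -
    obtain a b where ab: "a \<in> pts n" "x = \<sigma> a" "b \<in> pts n" "y = \<sigma> b"
      using permutes_pts_image[OF \<sigma> xy(1)] permutes_pts_image[OF \<sigma> xy(2)] by blast
    then have ne: "a \<noteq> b" using xy(3) by blast
    have "(\<forall>l\<in>{a..<b}. \<alpha> l \<in> D1) \<or> (\<forall>l\<in>{b..<a}. \<alpha> l \<in> D1)"
      by (cases "a \<le> b") simp_all
    then show ?thesis
      unfolding ab(2,4) presents_horocyclic[OF p ab(1,3) ne] presents_horocyclic[OF p ab(3,1) ne[symmetric]]
      by blast
  qed
  then show "biclosed n \<alpha> C \<and> (\<forall>x\<in>pts n. \<forall>y\<in>pts n. x \<noteq> y \<longrightarrow> \<not> (rel C x y \<and> rel C y x))"
    using presents_biclosed[OF p bitrans_on_dual[OF bitrans_on_all_below] presents_horocyclic[OF p]]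
    by blast
next
  assume h: "biclosed n \<alpha> C \<and> (\<forall>x\<in>pts n. \<forall>y\<in>pts n. x \<noteq> y \<longrightarrow> \<not> (rel C x y \<and> rel C y x))"
  then obtain \<sigma> D1 D2 where p: "presents \<sigma> D1 D2 C" using presents_exists by blast
  then have \<sigma>: "\<sigma> permutes pts n" and D2: "D2 \<subseteq> simple_roots n \<alpha>"
    unfolding presents_def orthogonal_simple_def by blast+
  have "\<alpha> l \<notin> D2" if l: "l \<in> {1..n}" for l
  proof
    assume "\<alpha> l \<in> D2"
    have pts: "l \<in> pts n" "l + 1 \<in> pts n" "l < l + 1" using l by auto
    have "\<sigma> l \<in> pts n" "\<sigma> (l + 1) \<in> pts n" using pts permutes_in_image[OF \<sigma>] by blast+
    moreover have "\<sigma> l \<noteq> \<sigma> (l + 1)" using permutes_inj[OF \<sigma>] by (simp add: inj_eq)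
    ultimately have "\<not> rel C (\<sigma> (l + 1)) (\<sigma> l)"
      using h presents_sorted[OF p pts] by blast
    then show False using presents_rel(2)[OF p pts] \<open>\<alpha> l \<in> D2\<close> by simp
  qed
  then have "D2 = {}" using D2 unfolding simple_roots_def by blast
  then show "horocyclic n \<alpha> C" using p horocyclic_iff_presents by blast
qed

text \<open>An identity is an isolated first point. Index 1 lies in every range
  \<open>{1..<b}\<close>, so excluding \<open>\<alpha> 1\<close> decides all relations with
  \<open>\<sigma> 1\<close>; conversely, sortedness forces \<open>e = \<sigma> 1\<close> in any
  presentation.\<close>

lemma has_identity_iff_presents:
  assumes "biclosed n \<alpha> C"
  shows "(\<exists>\<sigma> D1 D2. presents \<sigma> D1 D2 C \<and> \<alpha> 1 \<notin> D1 \<union> D2) \<longleftrightarrow>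
    (\<exists>e\<in>pts n. \<forall>x\<in>pts n. x \<noteq> e \<longrightarrow> rel C e x \<and> \<not> rel C x e)"
proof
  assume "\<exists>\<sigma> D1 D2. presents \<sigma> D1 D2 C \<and> \<alpha> 1 \<notin> D1 \<union> D2"
  then obtain \<sigma> D1 D2 where p: "presents \<sigma> D1 D2 C" and D: "\<alpha> 1 \<notin> D1" "\<alpha> 1 \<notin> D2" by blast
  have \<sigma>: "\<sigma> permutes pts n" using p unfolding presents_def by blast
  have one: "1 \<in> pts n" by simp
  show "\<exists>e\<in>pts n. \<forall>x\<in>pts n. x \<noteq> e \<longrightarrow> rel C e x \<and> \<not> rel C x e"
  proof (intro bexI ballI impI)
    show "\<sigma> 1 \<in> pts n" using permutes_in_image[OF \<sigma>] one by blast
    fix x assume x: "x \<in> pts n" "x \<noteq> \<sigma> 1"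
    obtain b where b: "b \<in> pts n" "x = \<sigma> b" using permutes_ptsE[OF \<sigma> x(1)] .
    have lt: "1 < b" using b x by (cases "b = 1") auto
    then have "1 \<in> {1..<b}" by simp
    then show "rel C (\<sigma> 1) x \<and> \<not> rel C x (\<sigma> 1)"
      using presents_rel[OF p one b(1) lt] D b(2) by blast
  qed
next
  assume "\<exists>e\<in>pts n. \<forall>x\<in>pts n. x \<noteq> e \<longrightarrow> rel C e x \<and> \<not> rel C x e"
  then obtain e where e: "e \<in> pts n" "\<And>x. x \<in> pts n \<Longrightarrow> x \<noteq> e \<Longrightarrow> rel C e x \<and> \<not> rel C x e"
    by blast
  obtain \<sigma> D1 D2 where p: "presents \<sigma> D1 D2 C" using presents_exists assms by blast
  have \<sigma>: "\<sigma> permutes pts n" using p unfolding presents_def by blast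
  obtain a where a: "a \<in> pts n" "e = \<sigma> a" using permutes_ptsE[OF \<sigma> e(1)] .
  \<comment> \<open>Here \<open>n \<ge> 1\<close> provides the second point, whose relation to the
    first reveals whether \<open>\<alpha> 1\<close> lies in \<open>D1\<close> or
    \<open>D2\<close>.\<close>
  have pts: "1 \<in> pts n" "2 \<in> pts n" "1 < (2::nat)" using n_pos by auto
  have in_pts: "\<sigma> 1 \<in> pts n" "\<sigma> 2 \<in> pts n" using pts permutes_in_image[OF \<sigma>] by blast+
  have "a = 1"
  proof (rule ccontr)
    assume "a \<noteq> 1"
    then have "\<sigma> 1 \<noteq> e" using a permutes_inj[OF \<sigma>] by (simp add: inj_eq)
    then show False
      using e(2)[OF in_pts(1)] presents_sorted[OF p pts(1) a(1)] a \<open>a \<noteq> 1\<close> by simp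
  qed
  then have "\<sigma> 2 \<noteq> e" using a permutes_inj[OF \<sigma>] by (simp add: inj_eq)
  then have "rel C (\<sigma> 1) (\<sigma> 2) \<and> \<not> rel C (\<sigma> 2) (\<sigma> 1)" using e(2)[OF in_pts(2)] a \<open>a = 1\<close> by simp
  moreover have "{1..<2} = {1::nat}" by auto
  ultimately have "\<alpha> 1 \<notin> D1 \<union> D2" using presents_rel[OF p pts] by simp
  then show "\<exists>\<sigma> D1 D2. presents \<sigma> D1 D2 C \<and> \<alpha> 1 \<notin> D1 \<union> D2" using p by blast
qed

text \<open>The same argument at the other end: a zero is an isolated last point, and
  \<open>\<alpha> n\<close> labels the step from \<open>n\<close> to \<open>n + 1\<close>.\<close>

lemma has_zero_iff_presents:
  assumes "biclosed n \<alpha> C"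
  shows "(\<exists>\<sigma> D1 D2. presents \<sigma> D1 D2 C \<and> \<alpha> n \<notin> D1 \<union> D2) \<longleftrightarrow>
    (\<exists>e\<in>pts n. \<forall>x\<in>pts n. x \<noteq> e \<longrightarrow> rel C x e \<and> \<not> rel C e x)"
proof
  assume "\<exists>\<sigma> D1 D2. presents \<sigma> D1 D2 C \<and> \<alpha> n \<notin> D1 \<union> D2"
  then obtain \<sigma> D1 D2 where p: "presents \<sigma> D1 D2 C" and D: "\<alpha> n \<notin> D1" "\<alpha> n \<notin> D2" by blast
  have \<sigma>: "\<sigma> permutes pts n" using p unfolding presents_def by blast
  have top: "n + 1 \<in> pts n" by simp
  show "\<exists>e\<in>pts n. \<forall>x\<in>pts n. x \<noteq> e \<longrightarrow> rel C x e \<and> \<not> rel C e x"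
  proof (intro bexI ballI impI)
    show "\<sigma> (n + 1) \<in> pts n" using permutes_in_image[OF \<sigma>] top by blast
    fix x assume x: "x \<in> pts n" "x \<noteq> \<sigma> (n + 1)"
    obtain b where b: "b \<in> pts n" "x = \<sigma> b" using permutes_ptsE[OF \<sigma> x(1)] .
    have lt: "b < n + 1" using b x by (cases "b = n + 1") auto
    then have "n \<in> {b..<n + 1}" by simp
    then show "rel C x (\<sigma> (n + 1)) \<and> \<not> rel C (\<sigma> (n + 1)) x"
      using presents_rel[OF p b(1) top lt] D b(2) by blast
  qed
next
  assume "\<exists>e\<in>pts n. \<forall>x\<in>pts n. x \<noteq> e \<longrightarrow> rel C x e \<and> \<not> rel C e x"
  then obtain e where e: "e \<in> pts n" "\<And>x. x \<in> pts n \<Longrightarrow> x \<noteq> e \<Longrightarrow> rel C x e \<and> \<not> rel C e x"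
    by blast
  obtain \<sigma> D1 D2 where p: "presents \<sigma> D1 D2 C" using presents_exists assms by blast
  have \<sigma>: "\<sigma> permutes pts n" using p unfolding presents_def by blast
  obtain a where a: "a \<in> pts n" "e = \<sigma> a" using permutes_ptsE[OF \<sigma> e(1)] .
  have pts: "n \<in> pts n" "n + 1 \<in> pts n" "n < n + 1" using n_pos by auto
  have in_pts: "\<sigma> n \<in> pts n" "\<sigma> (n + 1) \<in> pts n" using pts permutes_in_image[OF \<sigma>] by blast+
  have an: "a = n + 1"
  proof (rule ccontr)
    assume "a \<noteq> n + 1"
    then have "\<sigma> (n + 1) \<noteq> e" using a permutes_inj[OF \<sigma>] by (simp add: inj_eq)
    then show False
      using e(2)[OF in_pts(2)] presents_sorted[OF p a(1) pts(2)] a \<open>a \<noteq> n + 1\<close> by simp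
  qed
  then have "\<sigma> n \<noteq> e" using a permutes_inj[OF \<sigma>] by (simp add: inj_eq)
  then have "rel C (\<sigma> n) (\<sigma> (n + 1)) \<and> \<not> rel C (\<sigma> (n + 1)) (\<sigma> n)"
    using e(2)[OF in_pts(1)] a an by simp
  moreover have "{n..<n + 1} = {n}" by auto
  ultimately have "\<alpha> n \<notin> D1 \<union> D2" using presents_rel[OF p pts] by simp
  then show "\<exists>\<sigma> D1 D2. presents \<sigma> D1 D2 C \<and> \<alpha> n \<notin> D1 \<union> D2" using p by blast
qed

section \<open>Positive systems\<close>

text \<open>Reading the coordinates in the order given by \<open>\<sigma>\<close> makes
  \<open>root_ab \<alpha> (\<sigma> a) (\<sigma> b)\<close> positive for \<open>a < b\<close>, since
  its first non-zero coordinate is the 1 at position \<open>a\<close>.\<close>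

definition lex_less :: "(nat \<Rightarrow> nat) \<Rightarrow> 'v \<Rightarrow> 'v \<Rightarrow> bool" where
  "lex_less \<sigma> u v \<longleftrightarrow> (\<exists>k\<in>pts n. (\<forall>j\<in>pts n. j < k \<longrightarrow> eps (\<sigma> j) u = eps (\<sigma> j) v) \<and>
     eps (\<sigma> k) u < eps (\<sigma> k) v)"

lemma lex_less_trans: 
  assumes "lex_less \<sigma> u v" "lex_less \<sigma> v w"
  shows "lex_less \<sigma> u w"
proof -
  obtain k where k: "k \<in> pts n" "\<And>j. j \<in> pts n \<Longrightarrow> j < k \<Longrightarrow> eps (\<sigma> j) u = eps (\<sigma> j) v"
    "eps (\<sigma> k) u < eps (\<sigma> k) v"
    using assms(1) unfolding lex_less_def by blast
  obtain l where l: "l \<in> pts n" "\<And>j. j \<in> pts n \<Longrightarrow> j < l \<Longrightarrow> eps (\<sigma> j) v = eps (\<sigma> j) w"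
    "eps (\<sigma> l) v < eps (\<sigma> l) w"
    using assms(2) unfolding lex_less_def by blast
  have "eps (\<sigma> (min k l)) u < eps (\<sigma> (min k l)) w"
    using k l by (cases k l rule: linorder_cases) (auto simp: min_def)
  moreover have "\<forall>j\<in>pts n. j < min k l \<longrightarrow> eps (\<sigma> j) u = eps (\<sigma> j) w"
    using k(2) l(2) by simp
  moreover have "min k l \<in> pts n" using k(1) l(1) by (auto simp: min_def)
  ultimately show ?thesis unfolding lex_less_def by blast
qed

lemma lex_less_irrefl: "\<not> lex_less \<sigma> u u"
  by (simp add: lex_less_def)

lemma lex_less_total:
  assumes \<sigma>: "\<sigma> permutes pts n" and "u \<noteq> v"
  shows "lex_less \<sigma> u v \<or> lex_less \<sigma> v u"
proof -
  let ?P = "\<lambda>k. k \<in> pts n \<and> eps (\<sigma> k) u \<noteq> eps (\<sigma> k) v"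
  obtain i where "i \<in> pts n" "eps i u \<noteq> eps i v" using eps_eqI assms(2) by blast
  then have "\<exists>k. ?P k" using permutes_pts_image[OF \<sigma>] by blast
  then have k: "?P (Least ?P)" by (rule LeastI_ex)
  have eq: "eps (\<sigma> j) u = eps (\<sigma> j) v" if "j \<in> pts n" "j < Least ?P" for j
    using not_less_Least[OF that(2)] that(1) by blast
  consider "eps (\<sigma> (Least ?P)) u < eps (\<sigma> (Least ?P)) v" | "eps (\<sigma> (Least ?P)) v < eps (\<sigma> (Least ?P)) u"
    using k by linarith
  then show ?thesis
  proof cases
    case 1
    then have "lex_less \<sigma> u v"
      unfolding lex_less_def by (intro bexI[of _ "Least ?P"]) (use k eq in blast)+
    then show ?thesis ..
  next
    case 2
    then have "lex_less \<sigma> v u"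
      unfolding lex_less_def by (intro bexI[of _ "Least ?P"]) (use k eq[symmetric] in blast)+
    then show ?thesis ..
  qed
qed

lemma lex_less_root_ab:
  assumes \<sigma>: "\<sigma> permutes pts n" and ab: "a \<in> pts n" "b \<in> pts n" "a < b"
  shows "lex_less \<sigma> 0 (root_ab \<alpha> (\<sigma> a) (\<sigma> b))"
proof -
  have s: "\<sigma> j \<in> pts n" if "j \<in> pts n" for j using that permutes_in_image[OF \<sigma>] by blast
  have "eps (\<sigma> j) (root_ab \<alpha> (\<sigma> a) (\<sigma> b)) = of_bool (j = a) - of_bool (j = b)" if "j \<in> pts n" for j
    using eps_root_ab[OF s[OF ab(1)] s[OF ab(2)] s[OF that]] permutes_inj[OF \<sigma>]
    by (simp add: inj_eq)
  then show ?thesis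
    using ab linear_0[OF linear_eps] unfolding lex_less_def by (intro bexI[of _ a]) auto
qed

lemma lex_order:
  assumes "\<sigma> permutes pts n"
  shows "vector_space_total_order (\<lambda>u v. lex_less \<sigma> u v \<or> u = v) (lex_less \<sigma>)"
  unfolding vector_space_total_order_def
proof (intro conjI allI impI)
  show "class.linorder (\<lambda>u v. lex_less \<sigma> u v \<or> u = v) (lex_less \<sigma>)"
    by unfold_locales (use lex_less_trans lex_less_irrefl lex_less_total[OF assms] in blast)+
  fix u v w assume "lex_less \<sigma> u v \<or> u = v"
  then show "lex_less \<sigma> (u + w) (v + w) \<or> u + w = v + w"
    unfolding lex_less_def by (auto simp: linear_add[OF linear_eps])
next
  fix c :: real and u v assume "0 \<le> c" "lex_less \<sigma> u v \<or> u = v"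
  then show "lex_less \<sigma> (c *\<^sub>R u) (c *\<^sub>R v) \<or> c *\<^sub>R u = c *\<^sub>R v"
    \<comment> \<open>For \<open>c = 0\<close> strictness is lost and the equality alternative
      holds.\<close>
    unfolding lex_less_def by (cases "c = 0") (auto simp: linear_cmul[OF linear_eps])
qed

text \<open>Positive vectors are closed under addition, which gives transitivity. Exactly one of a
  root and its negative is positive, so the complement is the converse relation and is transitive
  too.\<close>

lemma positive_system_tournament:
  assumes "positive_system n \<alpha> P"
  shows "biclosed n \<alpha> P \<and> (\<forall>x\<in>pts n. \<forall>y\<in>pts n. x \<noteq> y \<longrightarrow> rel P x y = (\<not> rel P y x))"
proof -
  obtain le lt where ord: "vector_space_total_order le lt" and P: "P = {\<beta> \<in> roots n \<alpha>. lt 0 \<beta>}"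
    using assms unfolding positive_system_def by blast
  interpret o: linorder le lt using ord unfolding vector_space_total_order_def by blast
  have add: "le (u + w) (v + w)" if "le u v" for u v w
    using ord that unfolding vector_space_total_order_def by blast
  have pos_add: "lt 0 (u + v)" if "lt 0 u" "lt 0 v" for u v
    using add[of 0 u v] that o.less_le_trans[of 0 v "u + v"] by (simp add: o.less_imp_le)
  have neg: "lt 0 (- v) \<longleftrightarrow> lt v 0" for v
    using add[of 0 "- v" v] add[of v 0 "- v"] o.less_le by auto
  have rel: "rel P x y \<longleftrightarrow> lt 0 (root_ab \<alpha> x y)" if "x \<in> pts n" "y \<in> pts n" "x \<noteq> y" for x y
    using that root_ab_in_roots unfolding P by blast
  have tour: "rel P x y = (\<not> rel P y x)" if xy: "x \<in> pts n" "y \<in> pts n" "x \<noteq> y" for x y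
  proof -
    have "root_ab \<alpha> x y \<noteq> 0" using root_ab_in_roots[OF xy(1,2)] xy(3) zero_notin_roots by metis
    then show ?thesis
      using rel[OF xy] rel[OF xy(2,1)] xy(3) neg[of "root_ab \<alpha> x y"] root_ab_swap[of y x]
        o.less_linear[of 0 "root_ab \<alpha> x y"] o.less_asym by metis
  qed
  have trans: "rel P x z" if "x \<in> pts n" "y \<in> pts n" "z \<in> pts n" "x \<noteq> y" "y \<noteq> z" "x \<noteq> z"
    "rel P x y" "rel P y z" for x y z
    using pos_add[of "root_ab \<alpha> x y" "root_ab \<alpha> y z"] rel that root_ab_add[OF that(1-3)] by metis
  have "bitrans_on (pts n) (rel P)"
    unfolding bitrans_on_def
  proof (intro ballI impI)
    fix x y z assume h: "x \<in> pts n" "y \<in> pts n" "z \<in> pts n" "x \<noteq> y \<and> y \<noteq> z \<and> x \<noteq> z"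
    then show "(rel P x y \<longrightarrow> rel P y z \<longrightarrow> rel P x z) \<and> (\<not> rel P x y \<longrightarrow> \<not> rel P y z \<longrightarrow> \<not> rel P x z)"
      using trans[of x y z] trans[of z y x] tour[of x y] tour[of y z] tour[of x z] by blast
  qed
  moreover have "P \<subseteq> roots n \<alpha>" unfolding P by blast
  ultimately show ?thesis using tour unfolding biclosed_iff by blast
qed

text \<open>\<open>P\<close> is compared with the positive system \<open>Q\<close> of the
  lexicographic order for a presenting \<open>\<sigma>\<close>. Both contain exactly one root for
  each pair of points, and in both it points forward along \<open>\<sigma>\<close>.\<close>

lemma tournament_positive_system:
  assumes b: "biclosed n \<alpha> P"
    and tour: "\<forall>x\<in>pts n. \<forall>y\<in>pts n. x \<noteq> y \<longrightarrow> rel P x y = (\<not> rel P y x)"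
  shows "positive_system n \<alpha> P"
proof -
  obtain \<sigma> D1 D2 where p: "presents \<sigma> D1 D2 P" using presents_exists[OF b] by blast
  then have \<sigma>: "\<sigma> permutes pts n" unfolding presents_def by blast
  define Q where "Q = {\<beta> \<in> roots n \<alpha>. lex_less \<sigma> 0 \<beta>}"
  have Q: "positive_system n \<alpha> Q"
    unfolding positive_system_def Q_def using lex_order[OF \<sigma>] by blast
  note Qt = positive_system_tournament[OF Q]
  have main: "rel P (\<sigma> a) (\<sigma> b) \<and> \<not> rel P (\<sigma> b) (\<sigma> a) \<and> rel Q (\<sigma> a) (\<sigma> b) \<and> \<not> rel Q (\<sigma> b) (\<sigma> a)"
    if ab: "a \<in> pts n" "b \<in> pts n" "a < b" for a b
  proof -
    have s: "\<sigma> a \<in> pts n" "\<sigma> b \<in> pts n" using ab permutes_in_image[OF \<sigma>] by blast+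
    have ne: "\<sigma> a \<noteq> \<sigma> b" using ab(3) permutes_inj[OF \<sigma>] by (simp add: inj_eq)
    have "rel Q (\<sigma> a) (\<sigma> b)"
      unfolding Q_def using lex_less_root_ab[OF \<sigma> ab] root_ab_in_roots[OF s] ne by blast
    moreover have "rel P (\<sigma> a) (\<sigma> b)" using tour s ne presents_sorted[OF p ab] by blast
    ultimately show ?thesis using tour Qt s ne by blast
  qed
  have "P = Q"
  proof (rule roots_subset_eqI)
    show "P \<subseteq> roots n \<alpha>" using b unfolding biclosed_iff by blast
    show "Q \<subseteq> roots n \<alpha>" unfolding Q_def by blast
    fix x y assume xy: "x \<in> pts n" "y \<in> pts n" "x \<noteq> y"
    obtain a b where "a \<in> pts n" "x = \<sigma> a" "b \<in> pts n" "y = \<sigma> b"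
      using permutes_pts_image[OF \<sigma> xy(1)] permutes_pts_image[OF \<sigma> xy(2)] by blast
    then show "rel P x y = rel Q x y"
      using main[of a b] main[of b a] xy(3) by (cases a b rule: linorder_cases) blast+
  qed
  then show ?thesis using Q by simp
qed

lemma positive_system_iff:
  "positive_system n \<alpha> P \<longleftrightarrow> biclosed n \<alpha> P \<and>
     (\<forall>x\<in>pts n. \<forall>y\<in>pts n. x \<noteq> y \<longrightarrow> rel P x y = (\<not> rel P y x))"
  using positive_system_tournament tournament_positive_system by blast

lemma FC_positive_systems:
  "bij_betw (FC n \<alpha>) {P. positive_system n \<alpha> P}
     {F. quasitrivial_semigroup (pts n) F \<and> commutative_on (pts n) F}"
proof (rule FC_bij_sub)
  show "biclosed n \<alpha> P" if "positive_system n \<alpha> P" for P using that positive_system_tournament by blast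
  show "positive_system n \<alpha> P \<longleftrightarrow> commutative_on (pts n) (select_op (pts n) (rel P))"
    if "biclosed n \<alpha> P" for P
    using that by (simp only: commutative_select_op positive_system_iff simp_thms)
qed

section \<open>The correspondence\<close>

text \<open>Off the diagonal, a symmetric bitransitive relation and its complement behave like two
  complementary equivalence relations, and one of them must be everything.\<close>

lemma symmetric_biclosed_iff:
  assumes "biclosed n \<alpha> C"
  shows "C \<in> {{}, roots n \<alpha>} \<longleftrightarrow> (\<forall>x\<in>pts n. \<forall>y\<in>pts n. x \<noteq> y \<longrightarrow> rel C x y = rel C y x)"
proof
  assume "C \<in> {{}, roots n \<alpha>}"
  then show "\<forall>x\<in>pts n. \<forall>y\<in>pts n. x \<noteq> y \<longrightarrow> rel C x y = rel C y x"
    using root_ab_in_roots by blast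
next
  assume sym: "\<forall>x\<in>pts n. \<forall>y\<in>pts n. x \<noteq> y \<longrightarrow> rel C x y = rel C y x"
  have C: "C \<subseteq> roots n \<alpha>" and b: "bitrans_on (pts n) (rel C)"
    using assms unfolding biclosed_iff by blast+
  \<comment> \<open>If x is related to y but not to z, either truth value of the relation between y
    and z is contradictory: related transports \<open>rel C x y\<close> to z, and unrelated
    transports \<open>\<not> rel C x z\<close> to y.\<close>
  have step: "rel C x z" if xyz: "x \<in> pts n" "y \<in> pts n" "z \<in> pts n" "x \<noteq> y" "x \<noteq> z" "rel C x y"
    for x y z
  proof (rule ccontr)
    assume xz: "\<not> rel C x z"
    then have "y \<noteq> z" using xyz(6) by blast
    then show False
      using bitrans_onD(1)[OF b xyz(1,2,3,4) _ xyz(5)] bitrans_onD(2)[OF b xyz(1,3,2,5) _ xyz(4)]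
        sym xyz xz by blast
  qed
  show "C \<in> {{}, roots n \<alpha>}"
  proof (cases "C = {}")
    case False
    then obtain x y where xy: "x \<in> pts n" "y \<in> pts n" "x \<noteq> y" "rel C x y"
      using C unfolding roots_eq by blast
    have "rel C u v" if uv: "u \<in> pts n" "v \<in> pts n" "u \<noteq> v" for u v
    proof (cases "u = x")
      case True
      then show ?thesis using step[OF xy(1,2) uv(2) xy(3)] uv xy by blast
    next
      case False
      then have "rel C u x" using step[OF xy(1,2) uv(1) xy(3)] sym uv xy by blast
      then show ?thesis using step[OF uv(1) xy(1) uv(2) False uv(3)] by blast
    qed
    then have "roots n \<alpha> \<subseteq> C" unfolding roots_eq by blast
    then show ?thesis using C by blast
  qed simp
qed

lemma FC_anticommutative:
  "{F. quasitrivial_semigroup (pts n) F \<and> anticommutative_on (pts n) F} = {FC n \<alpha> {}, FC n \<alpha> (roots n \<alpha>)}"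
proof -
  have "bij_betw (FC n \<alpha>) {C. C \<in> {{}, roots n \<alpha>}}
     {F. quasitrivial_semigroup (pts n) F \<and> anticommutative_on (pts n) F}"
  proof (rule FC_bij_sub)
    show "biclosed n \<alpha> C" if "C \<in> {{}, roots n \<alpha>}" for C using that biclosed_trivial by blast
    show "C \<in> {{}, roots n \<alpha>} \<longleftrightarrow> anticommutative_on (pts n) (select_op (pts n) (rel C))"
      if "biclosed n \<alpha> C" for C
      using symmetric_biclosed_iff[OF that] by (simp only: anticommutative_select_op)
  qed
  from bij_betw_imp_surj_on[OF this] show ?thesis by auto
qed

lemma FC_identity:
  "bij_betw (FC n \<alpha>)
     {C. biclosed n \<alpha> C \<and>
         (\<exists>w D1 D2. w permutes pts n \<and> orthogonal_simple n \<alpha> D1 D2 \<and>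
            \<alpha> 1 \<notin> D1 \<union> D2 \<and> C = act n \<alpha> w (Phi2 n \<alpha> D1 D2))}
     {F. quasitrivial_semigroup (pts n) F \<and> has_identity_on (pts n) F}"
proof (rule FC_bij_sub)
  fix C assume b: "biclosed n \<alpha> C"
  have "(\<exists>w D1 D2. w permutes pts n \<and> orthogonal_simple n \<alpha> D1 D2 \<and>
            \<alpha> 1 \<notin> D1 \<union> D2 \<and> C = act n \<alpha> w (Phi2 n \<alpha> D1 D2)) \<longleftrightarrow>
      (\<exists>\<sigma> D1 D2. presents \<sigma> D1 D2 C \<and> \<alpha> 1 \<notin> D1 \<union> D2)"
    unfolding presents_def by blast
  then show "biclosed n \<alpha> C \<and> (\<exists>w D1 D2. w permutes pts n \<and> orthogonal_simple n \<alpha> D1 D2 \<and>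
            \<alpha> 1 \<notin> D1 \<union> D2 \<and> C = act n \<alpha> w (Phi2 n \<alpha> D1 D2)) \<longleftrightarrow>
      has_identity_on (pts n) (select_op (pts n) (rel C))"
    using b has_identity_iff_presents[OF b] unfolding has_identity_select_op by blast
qed blast

lemma FC_zero:
  "bij_betw (FC n \<alpha>)
     {C. biclosed n \<alpha> C \<and>
         (\<exists>w D1 D2. w permutes pts n \<and> orthogonal_simple n \<alpha> D1 D2 \<and>
            \<alpha> n \<notin> D1 \<union> D2 \<and> C = act n \<alpha> w (Phi2 n \<alpha> D1 D2))}
     {F. quasitrivial_semigroup (pts n) F \<and> has_zero_on (pts n) F}"
proof (rule FC_bij_sub)
  fix C assume b: "biclosed n \<alpha> C"
  have "(\<exists>w D1 D2. w permutes pts n \<and> orthogonal_simple n \<alpha> D1 D2 \<and>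
            \<alpha> n \<notin> D1 \<union> D2 \<and> C = act n \<alpha> w (Phi2 n \<alpha> D1 D2)) \<longleftrightarrow>
      (\<exists>\<sigma> D1 D2. presents \<sigma> D1 D2 C \<and> \<alpha> n \<notin> D1 \<union> D2)"
    unfolding presents_def by blast
  then show "biclosed n \<alpha> C \<and> (\<exists>w D1 D2. w permutes pts n \<and> orthogonal_simple n \<alpha> D1 D2 \<and>
            \<alpha> n \<notin> D1 \<union> D2 \<and> C = act n \<alpha> w (Phi2 n \<alpha> D1 D2)) \<longleftrightarrow>
      has_zero_on (pts n) (select_op (pts n) (rel C))"
    using b has_zero_iff_presents[OF b] unfolding has_zero_select_op by blast
qed blast

lemma FC_parabolic:
  "bij_betw (FC n \<alpha>) {C. parabolic n \<alpha> C}
     {F. quasitrivial_semigroup (pts n) F \<and>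
         (\<forall>x\<in>pts n. \<forall>y\<in>pts n. x \<noteq> y \<longrightarrow>
            restrict F ({x, y} \<times> {x, y}) \<noteq> restrict fst ({x, y} \<times> {x, y}))}"
proof (rule FC_bij_sub)
  show "biclosed n \<alpha> C" if "parabolic n \<alpha> C" for C using that unfolding parabolic_iff by (rule conjunct1)
  fix C assume b: "biclosed n \<alpha> C"
  let ?F = "select_op (pts n) (rel C)"
  have *: "(restrict ?F ({x, y} \<times> {x, y}) \<noteq> restrict fst ({x, y} \<times> {x, y})) \<longleftrightarrow> rel C x y \<or> rel C y x"
    if "x \<in> pts n" "y \<in> pts n" "x \<noteq> y" for x y
    unfolding restrict_pair_eq_iff select_op_apply[OF that(1,1)] select_op_apply[OF that(1,2)]
      select_op_apply[OF that(2,1)] select_op_apply[OF that(2,2)]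
    using that(3) by simp
  have "(\<forall>x\<in>pts n. \<forall>y\<in>pts n. x \<noteq> y \<longrightarrow>
      restrict ?F ({x, y} \<times> {x, y}) \<noteq> restrict fst ({x, y} \<times> {x, y})) \<longleftrightarrow>
      (\<forall>x\<in>pts n. \<forall>y\<in>pts n. x \<noteq> y \<longrightarrow> rel C x y \<or> rel C y x)"
    by (intro ball_cong imp_cong refl) (rule *)
  with b show "parabolic n \<alpha> C \<longleftrightarrow> (\<forall>x\<in>pts n. \<forall>y\<in>pts n. x \<noteq> y \<longrightarrow>
      restrict ?F ({x, y} \<times> {x, y}) \<noteq> restrict fst ({x, y} \<times> {x, y}))"
    by (simp only: parabolic_iff simp_thms)
qed

lemma FC_horocyclic:
  "bij_betw (FC n \<alpha>) {C. horocyclic n \<alpha> C}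
     {F. quasitrivial_semigroup (pts n) F \<and>
         (\<forall>x\<in>pts n. \<forall>y\<in>pts n. x \<noteq> y \<longrightarrow>
            restrict F ({x, y} \<times> {x, y}) \<noteq> restrict snd ({x, y} \<times> {x, y}))}"
proof (rule FC_bij_sub)
  show "biclosed n \<alpha> C" if "horocyclic n \<alpha> C" for C using that unfolding horocyclic_iff by (rule conjunct1)
  fix C assume b: "biclosed n \<alpha> C"
  let ?F = "select_op (pts n) (rel C)"
  have *: "(restrict ?F ({x, y} \<times> {x, y}) \<noteq> restrict snd ({x, y} \<times> {x, y})) \<longleftrightarrow> \<not> (rel C x y \<and> rel C y x)"
    if "x \<in> pts n" "y \<in> pts n" "x \<noteq> y" for x y
    unfolding restrict_pair_eq_iff select_op_apply[OF that(1,1)] select_op_apply[OF that(1,2)]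
      select_op_apply[OF that(2,1)] select_op_apply[OF that(2,2)]
    using that(3) by simp
  have "(\<forall>x\<in>pts n. \<forall>y\<in>pts n. x \<noteq> y \<longrightarrow>
      restrict ?F ({x, y} \<times> {x, y}) \<noteq> restrict snd ({x, y} \<times> {x, y})) \<longleftrightarrow>
      (\<forall>x\<in>pts n. \<forall>y\<in>pts n. x \<noteq> y \<longrightarrow> \<not> (rel C x y \<and> rel C y x))"
    by (intro ball_cong imp_cong refl) (rule *)
  with b show "horocyclic n \<alpha> C \<longleftrightarrow> (\<forall>x\<in>pts n. \<forall>y\<in>pts n. x \<noteq> y \<longrightarrow>
      restrict ?F ({x, y} \<times> {x, y}) \<noteq> restrict snd ({x, y} \<times> {x, y}))"
    by (simp only: horocyclic_iff simp_thms)
qed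

end

theorem proposition3p5:
  fixes n :: nat and \<alpha> :: "nat \<Rightarrow> 'v::real_vector"
  assumes "n \<ge> 1"
    and "inj_on \<alpha> {1..n}" and "independent (\<alpha> ` {1..n})" and "span (\<alpha> ` {1..n}) = UNIV"
  shows
    "bij_betw (FC n \<alpha>) {C. biclosed n \<alpha> C} {F. quasitrivial_semigroup (pts n) F} \<and>
     \<comment> \<open>(1)\<close>
     bij_betw (FC n \<alpha>) {P. positive_system n \<alpha> P}
       {F. quasitrivial_semigroup (pts n) F \<and> commutative_on (pts n) F} \<and>
     \<comment> \<open>(2)\<close>
     {F. quasitrivial_semigroup (pts n) F \<and> anticommutative_on (pts n) F} =
       {FC n \<alpha> {}, FC n \<alpha> (roots n \<alpha>)} \<and>
     FC n \<alpha> {} = FC n \<alpha> (Phi2 n \<alpha> (simple_roots n \<alpha>) {}) \<and>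
     FC n \<alpha> (roots n \<alpha>) = FC n \<alpha> (Phi2 n \<alpha> {} (simple_roots n \<alpha>)) \<and>
     \<comment> \<open>(3)\<close>
     bij_betw (FC n \<alpha>)
       {C. biclosed n \<alpha> C \<and>
           (\<exists>w D1 D2. w permutes pts n \<and> orthogonal_simple n \<alpha> D1 D2 \<and>
              \<alpha> 1 \<notin> D1 \<union> D2 \<and> C = act n \<alpha> w (Phi2 n \<alpha> D1 D2))}
       {F. quasitrivial_semigroup (pts n) F \<and> has_identity_on (pts n) F} \<and>
     bij_betw (FC n \<alpha>)
       {C. biclosed n \<alpha> C \<and>
           (\<exists>w D1 D2. w permutes pts n \<and> orthogonal_simple n \<alpha> D1 D2 \<and>
              \<alpha> n \<notin> D1 \<union> D2 \<and> C = act n \<alpha> w (Phi2 n \<alpha> D1 D2))}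
       {F. quasitrivial_semigroup (pts n) F \<and> has_zero_on (pts n) F} \<and>
     \<comment> \<open>(4)\<close>
     bij_betw (FC n \<alpha>) {C. parabolic n \<alpha> C}
       {F. quasitrivial_semigroup (pts n) F \<and>
           (\<forall>x\<in>pts n. \<forall>y\<in>pts n. x \<noteq> y \<longrightarrow>
              restrict F ({x, y} \<times> {x, y}) \<noteq> restrict fst ({x, y} \<times> {x, y}))} \<and>
     bij_betw (FC n \<alpha>) {C. horocyclic n \<alpha> C}
       {F. quasitrivial_semigroup (pts n) F \<and>
           (\<forall>x\<in>pts n. \<forall>y\<in>pts n. x \<noteq> y \<longrightarrow>
              restrict F ({x, y} \<times> {x, y}) \<noteq> restrict snd ({x, y} \<times> {x, y}))}"
proof -
  interpret type_A_basis n \<alpha> using assms by unfold_locales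
  show ?thesis
    \<comment> \<open>After this rewriting the two identities between presentations in part (2) are
      instances of reflexivity.\<close>
    unfolding Phi2_simple_empty Phi2_empty_simple
    by (intro conjI refl FC_bij FC_positive_systems FC_anticommutative FC_identity FC_zero
        FC_parabolic FC_horocyclic)
qed

end
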